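(* Let $\bar{\mathbf Q}^{-}$ and $\bar{\mathbf Q}^{+}$ be solutions of the semi-discrete discontinuous Galerkin approximation (described in the context) on two adjacent elements $\Omega_-$ and $\Omega_+$, with hat-variables at the external faces given by the boundary data and hat-variables at the common interface given by the interface data (described in the context). If the one-dimensional quadrature rule is exact, $\sum_{m=1}^{P+1} f(\xi_m)h_m=\int_0^1 f(\xi)\,d\xi$, for all polynomials $f$ of degree $\le 2P-1$, then the numerical solution satisfies $$\frac{d}{dt}\left(\mathcal E^-(t)+\mathcal E^+(t)\right)=\mathcal{IT}_s(\widehat v^{\pm},\widehat T^{\pm})+\mathcal{BT}_s(\widehat v^-,\widehat T^-)+\mathcal{BT}_s(\widehat v^+,\widehat T^+)+\mathcal F_{luc}(G^-,Z^-)+\mathcal F_{luc}(G^+,Z^+)\le 0 .$$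
   Context: **Fields and material.** $\mathbf Q=(v_x,v_y,v_z,\sigma_{xx},\sigma_{yy},\sigma_{zz},\sigma_{xy},\sigma_{xz},\sigma_{yz})^T\in\mathbb R^9$, $\mathbf v=(v_x,v_y,v_z)^T$, $\bar{\bar\sigma}$ is the symmetric $3\times3$ matrix with entries $\sigma_{xx},\sigma_{yy},\sigma_{zz}$ on the diagonal and $\sigma_{xy},\sigma_{xz},\sigma_{yz}$ off the diagonal. $\mathbf P=\mathrm{diag}(\rho^{-1}I_3,\mathbf C)$ with density $\rho>0$ and $\mathbf C$ a symmetric positive definite $6\times6$ stiffness matrix, both functions of position only. **Geometry.** Each element is the image of the reference cube $\widetilde\Omega=[0,1]^3\ni(q,r,s)$ under a smooth invertible map to $(x,y,z)$ with Jacobian determinant $J>0$. For $\xi\in\{q,r,s\}$, $\xi_x,\xi_y,\xi_z$ denote the partial derivatives of $\xi$ with respect to $x,y,z$, and $|\nabla\xi|:=\sqrt{\xi_x^2+\xi_y^2+\xi_z^2}$. Put $\widetilde{\mathbf P}=J^{-1}\mathbf P$. On a face $\xi=0$ or $\xi=1$ the unit normal pointing in the positive $\xi$ direction is $\mathbf n=(\xi_x,\xi_y,\xi_z)^T/|\nabla\xi|$; it is completed to an orthonormal basis $\mathbf n,\mathbf m,\mathbf l$ ($\mathbf l=\mathbf n\times\mathbf m$), and $\mathbf R$ is the orthogonal matrix with rows $\mathbf n^T,\mathbf m^T,\mathbf l^T$. Quantities of the elements $\Omega_\mp$ carry the superscript $\mp$. The two elements share one interface, which is the face $q=1$ of $\Omega_-$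 and the face $q=0$ of $\Omega_+$; the two maps agree there for all $(r,s)$, so that $J|\nabla q|$ and $\mathbf n$ agree from both sides, and the same $\mathbf m,\mathbf l$ are used on both sides. All other faces are external. **Fluxes.** For $\xi\in\{q,r,s\}$, $\mathbf F_\xi(\mathbf Q)=\big(J(\xi_x\sigma_{xx}+\xi_y\sigma_{xy}+\xi_z\sigma_{xz}),\,J(\xi_x\sigma_{xy}+\xi_y\sigma_{yy}+\xi_z\sigma_{yz}),\,J(\xi_x\sigma_{xz}+\xi_y\sigma_{yz}+\xi_z\sigma_{zz}),0,0,0,0,0,0\big)^T$, and $\mathbf B_\xi(\nabla\mathbf Q)=J\big(0,0,0,\ \xi_x\partial_\xi v_x,\ \xi_y\partial_\xi v_y,\ \xi_z\partial_\xi v_z,\ \xi_y\partial_\xi v_x+\xi_x\partial_\xi v_y,\ \xi_z\partial_\xi v_x+\xi_x\partial_\xi v_z,\ \xi_z\partial_\xi v_y+\xi_y\partial_\xi v_z\big)^T$. **Discrete operators.** $P\ge1$ is the polynomial degree; $\xi_1,\dots,\xi_{P+1}\in[0,1]$ are quadrature nodes with weights $h_1,\dots,h_{P+1}>0$; $\mathcal L_i$ are the Lagrange polynomials of degree $P$ at these nodes. $H=\mathrm{diag}(h_1,\dots,h_{P+1})$, $A_{ij}=\sum_m h_m\mathcal L_i(\xi_m)\mathcal L_j'(\xi_m)$, $D=H^{-1}A$. The degrees of freedom are $\bar{\mathbf Q}(t)=[\bar{\mathbf Q}_{ijk}(t)]$, $\bar{\mathbf Q}_{ijk}\in\mathbb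 R^9$, $1\le i,j,k\le P+1$ (values at node $(q_i,r_j,s_k)=(\xi_i,\xi_j,\xi_k)$). $\mathbf D_q,\mathbf D_r,\mathbf D_s$ apply $D$ in the first, second, third index respectively, to each of the 9 components; $\mathbf H_q,\mathbf H_r,\mathbf H_s$ apply $H$ likewise; $\mathbf H=\mathbf H_q\mathbf H_r\mathbf H_s$ (diagonal with entries $h_ih_jh_k$). With $e(\zeta)=(\mathcal L_1(\zeta),\dots,\mathcal L_{P+1}(\zeta))^T$, $\mathbf e_\xi(\zeta)$ applies $e(\zeta)$ in the index of $\xi$ (extending face data to nodal data), and $\mathbf e_\xi(\zeta)^T$ gives the value of the interpolant on the face $\xi=\zeta$ at the face nodes. **Semi-discrete scheme** (on each element, metric terms, $J$ and $\mathbf P$ evaluated at the nodes): $$\widetilde{\mathbf P}^{-1}\frac{d}{dt}\bar{\mathbf Q}=\sum_{\xi=q,r,s}\mathbf D_\xi\mathbf F_\xi(\bar{\mathbf Q})+\sum_{\xi=q,r,s}\mathbf B_\xi(\nabla_D\bar{\mathbf Q})-\mathbf{Flux}(\bar{\mathbf Q}),$$ where $\mathbf F_\xi(\bar{\mathbf Q})$ has nodal values $\mathbf F_\xi(\bar{\mathbf Q}_{ijk})$, $\mathbf B_\xi(\nabla_D\bar{\mathbf Q})$ is $\mathbf B_\xi$ with $\partial_\xi$ replaced by $\mathbf D_\xi$, and $$\mathbf{Flux}(\bar{\mathbf Q})=\sum_{\xi=q,r,s}\mathbf H_\xi^{-1}\Big(\mathbf e_\xi(0)\big[J|\nabla\xi|\,\mathbf{FL}\big]_{\xi=0}+\mathbf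 e_\xi(1)\big[J|\nabla\xi|\,\mathbf{FR}\big]_{\xi=1}\Big).$$ On faces, $\mathbf v$ is the face value of the interpolant of the velocity, and the traction $\mathbf T=(T_x,T_y,T_z)^T$ ($=\bar{\bar\sigma}\mathbf n$ when the face contains nodes) is determined by: $J|\nabla\xi|\mathbf T$ equals the first three components of the face value of the interpolant of $\mathbf F_\xi(\bar{\mathbf Q})$. Thus $\mathbf Q^T\mathbf F_\xi=J|\nabla\xi|\,\mathbf v^T\mathbf T$ on faces. Local components: $(v_n,v_m,v_l)^T=\mathbf R\mathbf v$, $(T_n,T_m,T_l)^T=\mathbf R\mathbf T$. **Hat-variables.** $Z_\eta>0$, $\eta=l,m,n$, are the impedances $Z_\eta=\rho c_\eta$, with effective wave speeds $c_n^2=\sum_{\xi=x,y,z}(n_\xi c_{p\xi})^2$, $c_m^2=\sum_\xi(n_\xi c_{sh\xi})^2$, $c_l^2=\sum_\xi(n_\xi c_{sv\xi})^2$, where $c_{p\xi},c_{sh\xi},c_{sv\xi}>0$ are the p- and s-wave speeds of the medium along the $\xi$-axis. Characteristics: $q_\eta=\frac12(Z_\eta v_\eta+T_\eta)$, $p_\eta=\frac12(Z_\eta v_\eta-T_\eta)$. External faces: with real reflection coefficients $|\gamma_\eta|\le1$, $\widehat v_\eta=\frac{1+\gamma_\eta}{Z_\eta}q_\eta,\ \widehat T_\eta=(1-\gamma_\eta)q_\eta$ at $\xi=0$; $\widehat v_\eta=\frac{1+\gamma_\eta}{Z_\eta}p_\eta,\ \widehat T_\eta=-(1-\gamma_\eta)p_\eta$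 at $\xi=1$. Interface: $q^+_\eta=\frac12(Z^+_\eta v^+_\eta+T^+_\eta)$, $p^-_\eta=\frac12(Z^-_\eta v^-_\eta-T^-_\eta)$, $\alpha_\eta=\frac{Z^+_\eta Z^-_\eta}{Z^+_\eta+Z^-_\eta}$, $\widehat T^\pm_\eta=\widehat T_\eta=\alpha_\eta\big(\frac{2}{Z^+_\eta}q^+_\eta-\frac{2}{Z^-_\eta}p^-_\eta\big)$, $\widehat v^+_\eta=\frac{2p^-_\eta+\widehat T_\eta}{Z^-_\eta}$, $\widehat v^-_\eta=\frac{2q^+_\eta-\widehat T_\eta}{Z^+_\eta}$; $[\![\widehat v_\eta]\!]=\widehat v^+_\eta-\widehat v^-_\eta$. **Fluctuations.** $G_\eta=\frac12Z_\eta(v_\eta-\widehat v_\eta)+\frac12(T_\eta-\widehat T_\eta)$ at $\xi=1$; $G_\eta=\frac12Z_\eta(v_\eta-\widehat v_\eta)-\frac12(T_\eta-\widehat T_\eta)$ at $\xi=0$; $\widetilde G_\eta=G_\eta/Z_\eta$. $(G_x,G_y,G_z)^T=\mathbf R^T(G_n,G_m,G_l)^T$, $(\widetilde G_x,\widetilde G_y,\widetilde G_z)^T=\mathbf R^T(\widetilde G_n,\widetilde G_m,\widetilde G_l)^T$. With $\mathbf w=(n_x\widetilde G_x,\,n_y\widetilde G_y,\,n_z\widetilde G_z,\,n_y\widetilde G_x+n_x\widetilde G_y,\,n_z\widetilde G_x+n_x\widetilde G_z,\,n_z\widetilde G_y+n_y\widetilde G_z)$: $\mathbf{FL}=(G_x,G_y,G_z,-\mathbf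 w)^T$, $\mathbf{FR}=(G_x,G_y,G_z,\mathbf w)^T$. **Energies and surface terms.** $\mathcal E^\pm(t)=\frac12\sum_{i,j,k=1}^{P+1}\big[(\bar{\mathbf Q}^\pm)^T(\widetilde{\mathbf P}^\pm)^{-1}\bar{\mathbf Q}^\pm\big]_{ijk}h_ih_jh_k$. For a face quantity $g$ write $\langle g\rangle=\sum_{\psi,\theta=1}^{P+1}g_{\psi\theta}h_\psi h_\theta$ (sum over face nodes). Then $\mathcal{IT}_s(\widehat v^\pm,\widehat T^\pm)=-\big\langle J|\nabla q|\sum_{\eta=l,m,n}\widehat T_\eta[\![\widehat v_\eta]\!]\big\rangle$ on the interface (which vanishes identically); $\mathcal F_{luc}(G,Z)=-\sum_{\xi=q,r,s}\Big(\big\langle J|\nabla\xi|\sum_\eta\frac{1}{Z_\eta}|G_\eta|^2\big\rangle_{\xi=0}+\big\langle J|\nabla\xi|\sum_\eta\frac{1}{Z_\eta}|G_\eta|^2\big\rangle_{\xi=1}\Big)$ for each element; $\mathcal{BT}_s(\widehat v^\pm,\widehat T^\pm)=\sum_{\xi=r,s}\Big(\big\langle J|\nabla\xi|\sum_\eta\widehat T^\pm_\eta\widehat v^\pm_\eta\big\rangle_{\xi=1}-\big\langle J|\nabla\xi|\sum_\eta\widehat T^\pm_\eta\widehat v^\pm_\eta\big\rangle_{\xi=0}\Big)+b^\pm$, with $b^-=-\big\langle J|\nabla q|\sum_\eta\widehat T^-_\eta\widehat v^-_\eta\big\rangle_{q=0}$ and $b^+=+\big\langle J|\nabla q|\sum_\eta\widehat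 T^+_\eta\widehat v^+_\eta\big\rangle_{q=1}$.
   Formalization: On faces containing no quadrature nodes, it is additionally assumed, at the time considered, that the traction T equals σn with σ the face value of the interpolated stress; without this the energy identity fails, e.g. for Gauss nodes on curved elements. *)

theory Defs
  imports "HOL-Analysis.Analysis" "HOL-Computational_Algebra.Polynomial"
begin

section \<open>Quadrature rule and one-dimensional operators\<close>

text \<open>Node and weight number \<open>i\<close> are meaningful for \<open>i \<in> {1..P+1}\<close> only.\<close>

record quadrature =
  qdeg :: nat
  qnode :: "nat \<Rightarrow> real"
  qweight :: "nat \<Rightarrow> real"

definition idx :: "quadrature \<Rightarrow> nat set" where
  "idx qr = {1..qdeg qr + 1}"

text \<open>Distinctness of the nodes is what makes the Lagrange basis exist.\<close>

definition valid_quadrature :: "quadrature \<Rightarrow> bool" where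
  "valid_quadrature qr \<longleftrightarrow>
     qdeg qr \<ge> 1 \<and> inj_on (qnode qr) (idx qr) \<and>
     (\<forall>i\<in>idx qr. qnode qr i \<in> {0..1} \<and> qweight qr i > 0)"

definition exact_up_to :: "quadrature \<Rightarrow> nat \<Rightarrow> bool" where
  "exact_up_to qr d \<longleftrightarrow>
     (\<forall>f :: real poly. degree f \<le> d \<longrightarrow>
        (\<Sum>m\<in>idx qr. poly f (qnode qr m) * qweight qr m) = integral {0..1} (poly f))"

definition lagrange :: "quadrature \<Rightarrow> nat \<Rightarrow> real poly" where
  "lagrange qr i =
     (\<Prod>j\<in>idx qr - {i}. smult (1 / (qnode qr i - qnode qr j)) [:- qnode qr j, 1:])"

definition A_mat :: "quadrature \<Rightarrow> nat \<Rightarrow> nat \<Rightarrow> real" where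
  "A_mat qr i j =
     (\<Sum>m\<in>idx qr. qweight qr m * poly (lagrange qr i) (qnode qr m)
                      * poly (pderiv (lagrange qr j)) (qnode qr m))"

text \<open>\<open>D = H\<^sup>-\<^sup>1 A\<close> with \<open>H\<close> the diagonal matrix of the weights.\<close>

definition D_mat :: "quadrature \<Rightarrow> nat \<Rightarrow> nat \<Rightarrow> real" where
  "D_mat qr i j = (1 / qweight qr i) * A_mat qr i j"


section \<open>States, nodal fields and face fields\<close>

text \<open>
  The reference directions \<open>q, r, s\<close>, the physical axes \<open>x, y, z\<close> and the local directions
  \<open>n, m, l\<close> are each numbered \<open>1, 2, 3\<close> by the index type \<open>3\<close>.

  A state in \<open>\<real>\<^sup>9\<close> is indexed by \<open>3 + 6\<close>: \<open>Inl\<close> carries the velocity, \<open>Inr\<close> the stresses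
  \<open>xx, yy, zz, xy, xz, yz\<close> in this order.
  Nodal data are indexed by multi-indices \<open>(i, j, k)\<close> of type \<open>nat ^ 3\<close>;
  face data by the two indices of the tangential directions, in increasing order.
\<close>

type_synonym state = "real ^ (3 + 6)"
type_synonym 'a nodal = "nat ^ 3 \<Rightarrow> 'a"
type_synonym 'a facedata = "nat \<Rightarrow> nat \<Rightarrow> 'a"

text \<open>A value for each direction \<open>\<xi>\<close> and each face \<open>\<xi> = \<zeta>\<close>, \<open>\<zeta> \<in> {0, 1}\<close>.\<close>

type_synonym 'a facefield = "3 \<Rightarrow> real \<Rightarrow> 'a facedata"

definition pack :: "real^3 \<Rightarrow> real^6 \<Rightarrow> state" where
  "pack u w = (\<chi> i. case i of Inl a \<Rightarrow> u $ a | Inr b \<Rightarrow> w $ b)"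

definition vel :: "state \<Rightarrow> real^3" where
  "vel Q = (\<chi> a. Q $ Inl a)"

definition stress :: "state \<Rightarrow> real^3^3" where
  "stress Q = vector
     [vector [Q $ Inr 1, Q $ Inr 4, Q $ Inr 5],
      vector [Q $ Inr 4, Q $ Inr 2, Q $ Inr 6],
      vector [Q $ Inr 5, Q $ Inr 6, Q $ Inr 3]]"

definition insert_dir :: "3 \<Rightarrow> 'a::zero \<Rightarrow> 'a \<Rightarrow> 'a \<Rightarrow> 'a ^ 3" where
  "insert_dir \<xi> c a b =
     (if \<xi> = 1 then vector [c, a, b] else if \<xi> = 2 then vector [a, c, b] else vector [a, b, c])"

definition restrict_dir :: "3 \<Rightarrow> 'a facedata \<Rightarrow> 'a nodal" where
  "restrict_dir \<xi> g m =
     (if \<xi> = 1 then g (m $ 2) (m $ 3) else if \<xi> = 2 then g (m $ 1) (m $ 3) else g (m $ 1) (m $ 2))"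

definition nodes :: "quadrature \<Rightarrow> (nat ^ 3) set" where
  "nodes qr = {m. \<forall>a. m $ a \<in> idx qr}"

definition node_pt :: "quadrature \<Rightarrow> nat ^ 3 \<Rightarrow> real ^ 3" where
  "node_pt qr m = (\<chi> a. qnode qr (m $ a))"

definition face_pt :: "quadrature \<Rightarrow> 3 \<Rightarrow> real \<Rightarrow> nat \<Rightarrow> nat \<Rightarrow> real ^ 3" where
  "face_pt qr \<xi> \<zeta> \<psi> \<theta> = insert_dir \<xi> \<zeta> (qnode qr \<psi>) (qnode qr \<theta>)"

text \<open>The operator \<open>D\<^sub>\<xi>\<close>.\<close>

definition D_op :: "quadrature \<Rightarrow> 3 \<Rightarrow> 'a::real_vector nodal \<Rightarrow> 'a nodal" where
  "D_op qr \<xi> f m = (\<Sum>l\<in>idx qr. D_mat qr (m $ \<xi>) l *\<^sub>R f (\<chi> a. if a = \<xi> then l else m $ a))"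

text \<open>The operator \<open>e\<^sub>\<xi>(\<zeta>)\<^sup>T\<close>.\<close>

definition face_val :: "quadrature \<Rightarrow> 3 \<Rightarrow> real \<Rightarrow> 'a::real_vector nodal \<Rightarrow> 'a facedata" where
  "face_val qr \<xi> \<zeta> f \<psi> \<theta> =
     (\<Sum>l\<in>idx qr. poly (lagrange qr l) \<zeta> *\<^sub>R f (insert_dir \<xi> l \<psi> \<theta>))"

text \<open>The operator \<open>e\<^sub>\<xi>(\<zeta>)\<close>, and \<open>H\<^sub>\<xi>\<^sup>-\<^sup>1\<close>.\<close>

definition face_ext :: "quadrature \<Rightarrow> 3 \<Rightarrow> real \<Rightarrow> 'a::real_vector facedata \<Rightarrow> 'a nodal" where
  "face_ext qr \<xi> \<zeta> g m = poly (lagrange qr (m $ \<xi>)) \<zeta> *\<^sub>R restrict_dir \<xi> g m"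

definition H_inv :: "quadrature \<Rightarrow> 3 \<Rightarrow> 'a::real_vector nodal \<Rightarrow> 'a nodal" where
  "H_inv qr \<xi> f m = (1 / qweight qr (m $ \<xi>)) *\<^sub>R f m"

definition face_sum :: "quadrature \<Rightarrow> real facedata \<Rightarrow> real" where
  "face_sum qr g = (\<Sum>\<psi>\<in>idx qr. \<Sum>\<theta>\<in>idx qr. g \<psi> \<theta> * qweight qr \<psi> * qweight qr \<theta>)"


section \<open>Elements: geometry, material, boundary data\<close>

text \<open>
  \<open>density\<close>, \<open>stiffness\<close> and the axial wave speeds depend on the physical position.
  \<open>tangent E \<xi> \<zeta> p\<close> is the tangent vector \<open>m\<close>, and \<open>refl E \<xi> \<zeta> p \<eta>\<close> the reflection
  coefficient \<open>\<gamma>\<^sub>\<eta>\<close>, at the point \<open>p\<close> of the reference face \<open>\<xi> = \<zeta>\<close>; the reflection coefficients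
  on the common interface are never used.
\<close>

record element =
  emap :: "real^3 \<Rightarrow> real^3"
  density :: "real^3 \<Rightarrow> real"
  stiffness :: "real^3 \<Rightarrow> real^6^6"
  speed_p :: "real^3 \<Rightarrow> real^3"
  speed_sh :: "real^3 \<Rightarrow> real^3"
  speed_sv :: "real^3 \<Rightarrow> real^3"
  tangent :: "3 \<Rightarrow> real \<Rightarrow> real^3 \<Rightarrow> real^3"
  refl :: "3 \<Rightarrow> real \<Rightarrow> real^3 \<Rightarrow> 3 \<Rightarrow> real"

definition ref_cube :: "(real^3) set" where
  "ref_cube = {p. \<forall>a. p $ a \<in> {0..1}}"

text \<open>\<open>k\<close> times continuously differentiable on \<open>S\<close>, with derivatives taken within \<open>S\<close>.\<close>

primrec Ck_on :: "nat \<Rightarrow> ('a::euclidean_space \<Rightarrow> 'b::euclidean_space) \<Rightarrow> 'a set \<Rightarrow> bool" where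
  "Ck_on 0 f S \<longleftrightarrow> continuous_on S f"
| "Ck_on (Suc k) f S \<longleftrightarrow>
     (\<exists>f'. (\<forall>x\<in>S. (f has_derivative f' x) (at x within S)) \<and> (\<forall>v. Ck_on k (\<lambda>x. f' x v) S))"

definition smooth_on :: "('a::euclidean_space \<Rightarrow> 'b::euclidean_space) \<Rightarrow> 'a set \<Rightarrow> bool" where
  "smooth_on f S \<longleftrightarrow> (\<forall>k. Ck_on k f S)"

definition Jac :: "element \<Rightarrow> real^3 \<Rightarrow> real" where
  "Jac E p = det (jacobian (emap E) (at p within ref_cube))"

text \<open>
  The metric terms \<open>(\<xi>\<^sub>x, \<xi>\<^sub>y, \<xi>\<^sub>z)\<close>, as functions of the reference point \<open>p\<close>: row \<open>\<xi>\<close> of the Jacobian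
  matrix of the inverse map at the image of \<open>p\<close>.
\<close>

definition grad :: "element \<Rightarrow> 3 \<Rightarrow> real^3 \<Rightarrow> real^3" where
  "grad E \<xi> p =
     jacobian (inv_into ref_cube (emap E)) (at (emap E p) within emap E ` ref_cube) $ \<xi>"

text \<open>The surface factor \<open>J |\<nabla>\<xi>|\<close>.\<close>

definition surf :: "element \<Rightarrow> 3 \<Rightarrow> real^3 \<Rightarrow> real" where
  "surf E \<xi> p = Jac E p * norm (grad E \<xi> p)"

definition normal :: "element \<Rightarrow> 3 \<Rightarrow> real^3 \<Rightarrow> real^3" where
  "normal E \<xi> p = (1 / norm (grad E \<xi> p)) *\<^sub>R grad E \<xi> p"

definition rot :: "element \<Rightarrow> 3 \<Rightarrow> real \<Rightarrow> real^3 \<Rightarrow> real^3^3" where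
  "rot E \<xi> \<zeta> p =
     vector [normal E \<xi> p, tangent E \<xi> \<zeta> p, cross3 (normal E \<xi> p) (tangent E \<xi> \<zeta> p)]"

definition sym_pos_def :: "real^'n^'n \<Rightarrow> bool" where
  "sym_pos_def C \<longleftrightarrow> transpose C = C \<and> (\<forall>u. u \<noteq> 0 \<longrightarrow> u \<bullet> (C *v u) > 0)"

definition valid_element :: "element \<Rightarrow> bool" where
  "valid_element E \<longleftrightarrow>
     smooth_on (emap E) ref_cube \<and> inj_on (emap E) ref_cube \<and> (\<forall>p\<in>ref_cube. Jac E p > 0) \<and>
     (\<forall>y\<in>emap E ` ref_cube.
        density E y > 0 \<and> sym_pos_def (stiffness E y) \<and>
        (\<forall>a. speed_p E y $ a > 0 \<and> speed_sh E y $ a > 0 \<and> speed_sv E y $ a > 0)) \<and>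
     (\<forall>\<xi>. \<forall>\<zeta>\<in>{0, 1}. \<forall>p\<in>ref_cube. p $ \<xi> = \<zeta> \<longrightarrow>
        norm (tangent E \<xi> \<zeta> p) = 1 \<and> normal E \<xi> p \<bullet> tangent E \<xi> \<zeta> p = 0 \<and>
        (\<forall>\<eta>. \<bar>refl E \<xi> \<zeta> p \<eta>\<bar> \<le> 1))"

text \<open>The face \<open>q = 1\<close> of the first element is the face \<open>q = 0\<close> of the second.\<close>

definition common_interface :: "element \<Rightarrow> element \<Rightarrow> bool" where
  "common_interface Em Ep \<longleftrightarrow>
     (\<forall>a\<in>{0..1}. \<forall>b\<in>{0..1}.
        emap Em (insert_dir 1 1 a b) = emap Ep (insert_dir 1 0 a b) \<and>
        tangent Em 1 1 (insert_dir 1 1 a b) = tangent Ep 1 0 (insert_dir 1 0 a b))"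

definition P_mat :: "element \<Rightarrow> real^3 \<Rightarrow> real^(3 + 6)^(3 + 6)" where
  "P_mat E p = (\<chi> i j. case (i, j) of
       (Inl a, Inl b) \<Rightarrow> if a = b then 1 / density E (emap E p) else 0
     | (Inr a, Inr b) \<Rightarrow> stiffness E (emap E p) $ a $ b
     | _ \<Rightarrow> 0)"

definition P_tilde :: "element \<Rightarrow> real^3 \<Rightarrow> real^(3 + 6)^(3 + 6)" where
  "P_tilde E p = (1 / Jac E p) *\<^sub>R P_mat E p"

definition impedance :: "element \<Rightarrow> 3 \<Rightarrow> real^3 \<Rightarrow> real^3" where
  "impedance E \<xi> p =
     (let n = normal E \<xi> p; y = emap E p;
          c = (\<lambda>s :: real^3. sqrt (\<Sum>a\<in>UNIV. (n $ a * s $ a)\<^sup>2))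
      in density E y *\<^sub>R vector [c (speed_p E y), c (speed_sh E y), c (speed_sv E y)])"


section \<open>Fluxes and face values\<close>

definition flux_F :: "element \<Rightarrow> 3 \<Rightarrow> real^3 \<Rightarrow> state \<Rightarrow> state" where
  "flux_F E \<xi> p Q = pack (Jac E p *\<^sub>R (stress Q *v grad E \<xi> p)) 0"

definition voigt :: "real^3 \<Rightarrow> real^3 \<Rightarrow> real^6" where
  "voigt g u = vector
     [g $ 1 * u $ 1, g $ 2 * u $ 2, g $ 3 * u $ 3,
      g $ 2 * u $ 1 + g $ 1 * u $ 2, g $ 3 * u $ 1 + g $ 1 * u $ 3, g $ 3 * u $ 2 + g $ 2 * u $ 3]"

text \<open>The argument \<open>dQ\<close> stands for the derivative of \<open>Q\<close> in direction \<open>\<xi>\<close>.\<close>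

definition flux_B :: "element \<Rightarrow> 3 \<Rightarrow> real^3 \<Rightarrow> state \<Rightarrow> state" where
  "flux_B E \<xi> p dQ = Jac E p *\<^sub>R pack 0 (voigt (grad E \<xi> p) (vel dQ))"

definition F_nodal :: "quadrature \<Rightarrow> element \<Rightarrow> 3 \<Rightarrow> state nodal \<Rightarrow> state nodal" where
  "F_nodal qr E \<xi> Q m = flux_F E \<xi> (node_pt qr m) (Q m)"

definition face_vel :: "quadrature \<Rightarrow> state nodal \<Rightarrow> (real^3) facefield" where
  "face_vel qr Q \<xi> \<zeta> \<psi> \<theta> = vel (face_val qr \<xi> \<zeta> Q \<psi> \<theta>)"

text \<open>
  The traction is obtained from the interpolant of the flux, not from the interpolant of the stress.
  The two agree on faces that contain nodes.
\<close>

definition face_traction :: "quadrature \<Rightarrow> element \<Rightarrow> state nodal \<Rightarrow> (real^3) facefield" where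
  "face_traction qr E Q \<xi> \<zeta> \<psi> \<theta> =
     (1 / surf E \<xi> (face_pt qr \<xi> \<zeta> \<psi> \<theta>)) *\<^sub>R vel (face_val qr \<xi> \<zeta> (F_nodal qr E \<xi> Q) \<psi> \<theta>)"

definition local_vel :: "quadrature \<Rightarrow> element \<Rightarrow> state nodal \<Rightarrow> (real^3) facefield" where
  "local_vel qr E Q \<xi> \<zeta> \<psi> \<theta> = rot E \<xi> \<zeta> (face_pt qr \<xi> \<zeta> \<psi> \<theta>) *v face_vel qr Q \<xi> \<zeta> \<psi> \<theta>"

definition local_traction :: "quadrature \<Rightarrow> element \<Rightarrow> state nodal \<Rightarrow> (real^3) facefield" where
  "local_traction qr E Q \<xi> \<zeta> \<psi> \<theta> =
     rot E \<xi> \<zeta> (face_pt qr \<xi> \<zeta> \<psi> \<theta>) *v face_traction qr E Q \<xi> \<zeta> \<psi> \<theta>"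


section \<open>Hat-variables\<close>

definition char_q :: "quadrature \<Rightarrow> element \<Rightarrow> state nodal \<Rightarrow> (real^3) facefield" where
  "char_q qr E Q \<xi> \<zeta> \<psi> \<theta> = (\<chi> \<eta>.
     (impedance E \<xi> (face_pt qr \<xi> \<zeta> \<psi> \<theta>) $ \<eta> * local_vel qr E Q \<xi> \<zeta> \<psi> \<theta> $ \<eta>
        + local_traction qr E Q \<xi> \<zeta> \<psi> \<theta> $ \<eta>) / 2)"

definition char_p :: "quadrature \<Rightarrow> element \<Rightarrow> state nodal \<Rightarrow> (real^3) facefield" where
  "char_p qr E Q \<xi> \<zeta> \<psi> \<theta> = (\<chi> \<eta>.
     (impedance E \<xi> (face_pt qr \<xi> \<zeta> \<psi> \<theta>) $ \<eta> * local_vel qr E Q \<xi> \<zeta> \<psi> \<theta> $ \<eta>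
        - local_traction qr E Q \<xi> \<zeta> \<psi> \<theta> $ \<eta>) / 2)"

definition vhat_ext :: "quadrature \<Rightarrow> element \<Rightarrow> state nodal \<Rightarrow> (real^3) facefield" where
  "vhat_ext qr E Q \<xi> \<zeta> \<psi> \<theta> = (\<chi> \<eta>.
     let p = face_pt qr \<xi> \<zeta> \<psi> \<theta>; \<gamma> = refl E \<xi> \<zeta> p \<eta>; Z = impedance E \<xi> p $ \<eta>
     in if \<zeta> = 0 then (1 + \<gamma>) / Z * char_q qr E Q \<xi> \<zeta> \<psi> \<theta> $ \<eta>
        else (1 + \<gamma>) / Z * char_p qr E Q \<xi> \<zeta> \<psi> \<theta> $ \<eta>)"

definition That_ext :: "quadrature \<Rightarrow> element \<Rightarrow> state nodal \<Rightarrow> (real^3) facefield" where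
  "That_ext qr E Q \<xi> \<zeta> \<psi> \<theta> = (\<chi> \<eta>.
     let \<gamma> = refl E \<xi> \<zeta> (face_pt qr \<xi> \<zeta> \<psi> \<theta>) \<eta>
     in if \<zeta> = 0 then (1 - \<gamma>) * char_q qr E Q \<xi> \<zeta> \<psi> \<theta> $ \<eta>
        else - ((1 - \<gamma>) * char_p qr E Q \<xi> \<zeta> \<psi> \<theta> $ \<eta>))"

text \<open>Impedances of the two elements at the nodes of the interface.\<close>

definition Z_minus :: "quadrature \<Rightarrow> element \<Rightarrow> (real^3) facedata" where
  "Z_minus qr Em \<psi> \<theta> = impedance Em 1 (face_pt qr 1 1 \<psi> \<theta>)"

definition Z_plus :: "quadrature \<Rightarrow> element \<Rightarrow> (real^3) facedata" where
  "Z_plus qr Ep \<psi> \<theta> = impedance Ep 1 (face_pt qr 1 0 \<psi> \<theta>)"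

definition That_int ::
  "quadrature \<Rightarrow> element \<Rightarrow> element \<Rightarrow> state nodal \<Rightarrow> state nodal \<Rightarrow> (real^3) facedata" where
  "That_int qr Em Ep Qm Qp \<psi> \<theta> = (\<chi> \<eta>.
     let Zm = Z_minus qr Em \<psi> \<theta> $ \<eta>; Zp = Z_plus qr Ep \<psi> \<theta> $ \<eta>; \<alpha> = Zp * Zm / (Zp + Zm)
     in \<alpha> * (2 / Zp * char_q qr Ep Qp 1 0 \<psi> \<theta> $ \<eta> - 2 / Zm * char_p qr Em Qm 1 1 \<psi> \<theta> $ \<eta>))"

definition vhat_int_plus ::
  "quadrature \<Rightarrow> element \<Rightarrow> element \<Rightarrow> state nodal \<Rightarrow> state nodal \<Rightarrow> (real^3) facedata" where
  "vhat_int_plus qr Em Ep Qm Qp \<psi> \<theta> = (\<chi> \<eta>.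
     (2 * char_p qr Em Qm 1 1 \<psi> \<theta> $ \<eta> + That_int qr Em Ep Qm Qp \<psi> \<theta> $ \<eta>)
       / Z_minus qr Em \<psi> \<theta> $ \<eta>)"

definition vhat_int_minus ::
  "quadrature \<Rightarrow> element \<Rightarrow> element \<Rightarrow> state nodal \<Rightarrow> state nodal \<Rightarrow> (real^3) facedata" where
  "vhat_int_minus qr Em Ep Qm Qp \<psi> \<theta> = (\<chi> \<eta>.
     (2 * char_q qr Ep Qp 1 0 \<psi> \<theta> $ \<eta> - That_int qr Em Ep Qm Qp \<psi> \<theta> $ \<eta>)
       / Z_plus qr Ep \<psi> \<theta> $ \<eta>)"

definition vhat_minus ::
  "quadrature \<Rightarrow> element \<Rightarrow> element \<Rightarrow> state nodal \<Rightarrow> state nodal \<Rightarrow> (real^3) facefield" where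
  "vhat_minus qr Em Ep Qm Qp \<xi> \<zeta> =
     (if \<xi> = 1 \<and> \<zeta> = 1 then vhat_int_minus qr Em Ep Qm Qp else vhat_ext qr Em Qm \<xi> \<zeta>)"

definition That_minus ::
  "quadrature \<Rightarrow> element \<Rightarrow> element \<Rightarrow> state nodal \<Rightarrow> state nodal \<Rightarrow> (real^3) facefield" where
  "That_minus qr Em Ep Qm Qp \<xi> \<zeta> =
     (if \<xi> = 1 \<and> \<zeta> = 1 then That_int qr Em Ep Qm Qp else That_ext qr Em Qm \<xi> \<zeta>)"

definition vhat_plus ::
  "quadrature \<Rightarrow> element \<Rightarrow> element \<Rightarrow> state nodal \<Rightarrow> state nodal \<Rightarrow> (real^3) facefield" where
  "vhat_plus qr Em Ep Qm Qp \<xi> \<zeta> =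
     (if \<xi> = 1 \<and> \<zeta> = 0 then vhat_int_plus qr Em Ep Qm Qp else vhat_ext qr Ep Qp \<xi> \<zeta>)"

definition That_plus ::
  "quadrature \<Rightarrow> element \<Rightarrow> element \<Rightarrow> state nodal \<Rightarrow> state nodal \<Rightarrow> (real^3) facefield" where
  "That_plus qr Em Ep Qm Qp \<xi> \<zeta> =
     (if \<xi> = 1 \<and> \<zeta> = 0 then That_int qr Em Ep Qm Qp else That_ext qr Ep Qp \<xi> \<zeta>)"


section \<open>Fluctuations and the semi-discrete scheme\<close>

text \<open>The local components \<open>(G\<^sub>n, G\<^sub>m, G\<^sub>l)\<close>, for given hat-variables \<open>vh\<close>, \<open>Th\<close>.\<close>

definition fluct ::
  "quadrature \<Rightarrow> element \<Rightarrow> state nodal \<Rightarrow> (real^3) facefield \<Rightarrow> (real^3) facefield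
     \<Rightarrow> (real^3) facefield" where
  "fluct qr E Q vh Th \<xi> \<zeta> \<psi> \<theta> = (\<chi> \<eta>.
     let Z = impedance E \<xi> (face_pt qr \<xi> \<zeta> \<psi> \<theta>) $ \<eta>;
         dv = local_vel qr E Q \<xi> \<zeta> \<psi> \<theta> $ \<eta> - vh \<xi> \<zeta> \<psi> \<theta> $ \<eta>;
         dT = local_traction qr E Q \<xi> \<zeta> \<psi> \<theta> $ \<eta> - Th \<xi> \<zeta> \<psi> \<theta> $ \<eta>
     in if \<zeta> = 1 then Z * dv / 2 + dT / 2 else Z * dv / 2 - dT / 2)"

definition fluct_xyz ::
  "quadrature \<Rightarrow> element \<Rightarrow> state nodal \<Rightarrow> (real^3) facefield \<Rightarrow> (real^3) facefield
     \<Rightarrow> (real^3) facefield" where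
  "fluct_xyz qr E Q vh Th \<xi> \<zeta> \<psi> \<theta> =
     transpose (rot E \<xi> \<zeta> (face_pt qr \<xi> \<zeta> \<psi> \<theta>)) *v fluct qr E Q vh Th \<xi> \<zeta> \<psi> \<theta>"

definition fluct_tilde_xyz ::
  "quadrature \<Rightarrow> element \<Rightarrow> state nodal \<Rightarrow> (real^3) facefield \<Rightarrow> (real^3) facefield
     \<Rightarrow> (real^3) facefield" where
  "fluct_tilde_xyz qr E Q vh Th \<xi> \<zeta> \<psi> \<theta> =
     (let p = face_pt qr \<xi> \<zeta> \<psi> \<theta>
      in transpose (rot E \<xi> \<zeta> p) *v (\<chi> \<eta>. fluct qr E Q vh Th \<xi> \<zeta> \<psi> \<theta> $ \<eta> / impedance E \<xi> p $ \<eta>))"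

text \<open>\<open>FR\<close> at \<open>\<zeta> = 1\<close>, \<open>FL\<close> at \<open>\<zeta> = 0\<close>.\<close>

definition FLR ::
  "quadrature \<Rightarrow> element \<Rightarrow> state nodal \<Rightarrow> (real^3) facefield \<Rightarrow> (real^3) facefield
     \<Rightarrow> state facefield" where
  "FLR qr E Q vh Th \<xi> \<zeta> \<psi> \<theta> =
     (let w = voigt (normal E \<xi> (face_pt qr \<xi> \<zeta> \<psi> \<theta>)) (fluct_tilde_xyz qr E Q vh Th \<xi> \<zeta> \<psi> \<theta>)
      in pack (fluct_xyz qr E Q vh Th \<xi> \<zeta> \<psi> \<theta>) (if \<zeta> = 1 then w else - w))"

definition num_Flux ::
  "quadrature \<Rightarrow> element \<Rightarrow> state nodal \<Rightarrow> (real^3) facefield \<Rightarrow> (real^3) facefield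
     \<Rightarrow> state nodal" where
  "num_Flux qr E Q vh Th m =
     (\<Sum>\<xi>\<in>UNIV. H_inv qr \<xi>
        (\<lambda>m. face_ext qr \<xi> 0
                (\<lambda>\<psi> \<theta>. surf E \<xi> (face_pt qr \<xi> 0 \<psi> \<theta>) *\<^sub>R FLR qr E Q vh Th \<xi> 0 \<psi> \<theta>) m
           + face_ext qr \<xi> 1
                (\<lambda>\<psi> \<theta>. surf E \<xi> (face_pt qr \<xi> 1 \<psi> \<theta>) *\<^sub>R FLR qr E Q vh Th \<xi> 1 \<psi> \<theta>) m) m)"

definition scheme_rhs ::
  "quadrature \<Rightarrow> element \<Rightarrow> state nodal \<Rightarrow> (real^3) facefield \<Rightarrow> (real^3) facefield
     \<Rightarrow> state nodal" where
  "scheme_rhs qr E Q vh Th m =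
     (\<Sum>\<xi>\<in>UNIV. D_op qr \<xi> (F_nodal qr E \<xi> Q) m)
     + (\<Sum>\<xi>\<in>UNIV. flux_B E \<xi> (node_pt qr m) (D_op qr \<xi> Q m))
     - num_Flux qr E Q vh Th m"

definition semidiscrete_solution ::
  "quadrature \<Rightarrow> element \<Rightarrow> real set \<Rightarrow> (real \<Rightarrow> state nodal)
     \<Rightarrow> (real \<Rightarrow> (real^3) facefield) \<Rightarrow> (real \<Rightarrow> (real^3) facefield) \<Rightarrow> bool" where
  "semidiscrete_solution qr E I Q vh Th \<longleftrightarrow>
     (\<forall>t\<in>I. \<forall>m\<in>nodes qr. \<exists>Q'.
        ((\<lambda>\<tau>. Q \<tau> m) has_vector_derivative Q') (at t within I) \<and>
        matrix_inv (P_tilde E (node_pt qr m)) *v Q' = scheme_rhs qr E (Q t) (vh t) (Th t) m)"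

text \<open>
  The stress part of \<open>FL\<close> and \<open>FR\<close> is paired with the face value of the interpolated stress, so
  the energy balance needs the identity \<open>T = \<sigma> n\<close> between that stress and the traction. It is
  automatic on a face containing nodes; on a face without nodes it holds for instance
  if the metric terms \<open>J \<xi>\<^sub>x, J \<xi>\<^sub>y, J \<xi>\<^sub>z\<close> do not vary in direction \<open>\<xi>\<close>, but not for every curved element.
\<close>

definition traction_compatible :: "quadrature \<Rightarrow> element \<Rightarrow> state nodal \<Rightarrow> bool" where
  "traction_compatible qr E Q \<longleftrightarrow>
     (\<forall>\<xi>. \<forall>\<zeta>\<in>{0, 1}. \<zeta> \<notin> qnode qr ` idx qr \<longrightarrow>
        (\<forall>\<psi>\<in>idx qr. \<forall>\<theta>\<in>idx qr.
           face_traction qr E Q \<xi> \<zeta> \<psi> \<theta>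
             = stress (face_val qr \<xi> \<zeta> Q \<psi> \<theta>) *v normal E \<xi> (face_pt qr \<xi> \<zeta> \<psi> \<theta>)))"


section \<open>Energy and surface terms\<close>

definition energy :: "quadrature \<Rightarrow> element \<Rightarrow> state nodal \<Rightarrow> real" where
  "energy qr E Q =
     1/2 * (\<Sum>i\<in>idx qr. \<Sum>j\<in>idx qr. \<Sum>k\<in>idx qr.
        (let m = vector [i, j, k] in Q m \<bullet> (matrix_inv (P_tilde E (node_pt qr m)) *v Q m))
          * qweight qr i * qweight qr j * qweight qr k)"

text \<open>By \<open>common_interface\<close> the surface factor may be taken from either side; here the first element.\<close>

definition IT_s ::
  "quadrature \<Rightarrow> element \<Rightarrow> element \<Rightarrow> state nodal \<Rightarrow> state nodal \<Rightarrow> real" where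
  "IT_s qr Em Ep Qm Qp =
     - face_sum qr (\<lambda>\<psi> \<theta>. surf Em 1 (face_pt qr 1 1 \<psi> \<theta>) *
          (\<Sum>\<eta>\<in>UNIV. That_int qr Em Ep Qm Qp \<psi> \<theta> $ \<eta> *
             (vhat_int_plus qr Em Ep Qm Qp \<psi> \<theta> $ \<eta> - vhat_int_minus qr Em Ep Qm Qp \<psi> \<theta> $ \<eta>)))"

definition F_luc ::
  "quadrature \<Rightarrow> element \<Rightarrow> state nodal \<Rightarrow> (real^3) facefield \<Rightarrow> (real^3) facefield \<Rightarrow> real" where
  "F_luc qr E Q vh Th =
     - (\<Sum>\<xi>\<in>UNIV. \<Sum>\<zeta>\<in>{0, 1}.
          face_sum qr (\<lambda>\<psi> \<theta>. surf E \<xi> (face_pt qr \<xi> \<zeta> \<psi> \<theta>) *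
            (\<Sum>\<eta>\<in>UNIV. 1 / impedance E \<xi> (face_pt qr \<xi> \<zeta> \<psi> \<theta>) $ \<eta>
                         * \<bar>fluct qr E Q vh Th \<xi> \<zeta> \<psi> \<theta> $ \<eta>\<bar>\<^sup>2)))"

definition face_power ::
  "quadrature \<Rightarrow> element \<Rightarrow> (real^3) facefield \<Rightarrow> (real^3) facefield \<Rightarrow> 3 \<Rightarrow> real \<Rightarrow> real" where
  "face_power qr E vh Th \<xi> \<zeta> =
     face_sum qr (\<lambda>\<psi> \<theta>. surf E \<xi> (face_pt qr \<xi> \<zeta> \<psi> \<theta>) *
       (\<Sum>\<eta>\<in>UNIV. Th \<xi> \<zeta> \<psi> \<theta> $ \<eta> * vh \<xi> \<zeta> \<psi> \<theta> $ \<eta>))"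

definition BT_minus ::
  "quadrature \<Rightarrow> element \<Rightarrow> (real^3) facefield \<Rightarrow> (real^3) facefield \<Rightarrow> real" where
  "BT_minus qr E vh Th =
     (\<Sum>\<xi>\<in>{2, 3}. face_power qr E vh Th \<xi> 1 - face_power qr E vh Th \<xi> 0)
     - face_power qr E vh Th 1 0"

definition BT_plus ::
  "quadrature \<Rightarrow> element \<Rightarrow> (real^3) facefield \<Rightarrow> (real^3) facefield \<Rightarrow> real" where
  "BT_plus qr E vh Th =
     (\<Sum>\<xi>\<in>{2, 3}. face_power qr E vh Th \<xi> 1 - face_power qr E vh Th \<xi> 0)
     + face_power qr E vh Th 1 1"

end

theory Submission
  imports Defs
begin

text \<open>
  Exactness up to degree \<open>2P - 1\<close> integrates \<open>(L\<^sub>i L\<^sub>j)'\<close> exactly, so \<open>A + A\<^sup>T\<close> is a pure boundary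
  term. The non-conservative stress terms pair with the velocity through the same matrix \<open>\<sigma>\<close> as the
  flux, hence the volume terms of the energy rate collapse to \<open>\<langle>J |\<nabla>\<xi>| v\<^sup>T T\<rangle>\<close> on the faces. With
  \<open>q = (Z v + T) / 2\<close>, \<open>p = (Z v - T) / 2\<close> one has \<open>v T = (q\<^sup>2 - p\<^sup>2) / Z\<close>; the hat-variables keep \<open>p\<close> at
  \<open>\<xi> = 1\<close> and \<open>q\<close> at \<open>\<xi> = 0\<close>, so that \<open>G\<close> is the change of the other characteristic, and completing
  the square turns \<open>v T\<close> minus the penalty into the power of the hat-variables minus \<open>G\<^sup>2 / Z\<close>. At the
  interface the two powers cancel because \<open>J \<nabla>q = x\<^sub>r \<times> x\<^sub>s\<close> involves tangential derivatives only.
\<close>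

section \<open>Summation by parts\<close>

lemma finite_idx [simp]: "finite (idx qr)"
  by (simp add: idx_def)

lemma poly_lagrange_node:
  assumes "inj_on (qnode qr) (idx qr)" "i \<in> idx qr" "j \<in> idx qr"
  shows "poly (lagrange qr i) (qnode qr j) = (if i = j then 1 else 0)"
proof (cases "i = j")
  case True
  have "qnode qr i \<noteq> qnode qr k" if "k \<in> idx qr - {i}" for k
    using that assms by (auto dest: inj_onD)
  then show ?thesis
    using True by (auto simp: lagrange_def poly_prod simp flip: diff_divide_distrib intro!: prod.neutral)
next
  case False
  then have "(\<Prod>k\<in>idx qr - {i}. poly (smult (1 / (qnode qr i - qnode qr k)) [:- qnode qr k, 1:]) (qnode qr j)) = 0"
    using assms by (intro prod_zero) (auto intro!: bexI[of _ j])
  then show ?thesis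
    using False by (simp add: lagrange_def poly_prod)
qed

lemma degree_lagrange_le:
  assumes "i \<in> idx qr"
  shows "degree (lagrange qr i) \<le> qdeg qr"
proof -
  have "degree (lagrange qr i)
          \<le> (\<Sum>j\<in>idx qr - {i}. degree (smult (1 / (qnode qr i - qnode qr j)) [:- qnode qr j, 1:]))"
    unfolding lagrange_def
    using degree_prod_sum_le[of "idx qr - {i}" "\<lambda>j. smult (1 / (qnode qr i - qnode qr j)) [:- qnode qr j, 1:]"]
    by (simp add: o_def)
  also have "\<dots> \<le> (\<Sum>j\<in>idx qr - {i}. 1)"
    by (rule sum_mono) (auto intro: order.trans[OF degree_smult_le])
  also have "\<dots> = qdeg qr"
    using assms by (simp add: idx_def)
  finally show ?thesis .
qed

text \<open>By the product rule the two quadrature sums add up to that of the derivative of the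
  product of the two Lagrange polynomials, whose degree is at most \<open>2 * P - 1\<close>. The
  rule integrates it exactly and the fundamental theorem of calculus leaves the endpoint values, so
  0 and 1 need not be nodes.\<close>

lemma A_mat_add_transpose:
  assumes "exact_up_to qr (2 * qdeg qr - 1)" "i \<in> idx qr" "j \<in> idx qr"
  shows "A_mat qr i j + A_mat qr j i
           = poly (lagrange qr i) 1 * poly (lagrange qr j) 1 - poly (lagrange qr i) 0 * poly (lagrange qr j) 0"
proof -
  define f where "f = lagrange qr i * lagrange qr j"
  have "degree f \<le> 2 * qdeg qr"
    using degree_mult_le[of "lagrange qr i" "lagrange qr j"] degree_lagrange_le[OF assms(2)]
      degree_lagrange_le[OF assms(3)] by (simp add: f_def)
  then have "degree (pderiv f) \<le> 2 * qdeg qr - 1"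
    by (simp add: degree_pderiv)
  then have "(\<Sum>m\<in>idx qr. poly (pderiv f) (qnode qr m) * qweight qr m) = integral {0..1} (poly (pderiv f))"
    using assms(1) by (simp add: exact_up_to_def)
  also have "\<dots> = poly f 1 - poly f 0"
    by (rule integral_unique, rule fundamental_theorem_of_calculus)
       (auto simp flip: has_real_derivative_iff_has_vector_derivative
             intro: DERIV_subset[OF poly_DERIV])
  finally show ?thesis
    by (simp add: f_def A_mat_def pderiv_mult algebra_simps flip: sum.distrib)
qed

text \<open>The weight cancels the inverse of \<open>H\<close> in \<open>D\<close>, and relabelling
  makes \<open>A\<close> plus its transpose the coefficient of \<open>f i \<bullet> g j\<close>.
  Values in an inner product space allow vector-valued data, here velocities and fluxes.\<close>

lemma summation_by_parts:
  fixes f g :: "nat \<Rightarrow> 'a::real_inner"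
  assumes "valid_quadrature qr" "exact_up_to qr (2 * qdeg qr - 1)"
  shows "(\<Sum>i\<in>idx qr. qweight qr i * (f i \<bullet> (\<Sum>j\<in>idx qr. D_mat qr i j *\<^sub>R g j)
             + (\<Sum>j\<in>idx qr. D_mat qr i j *\<^sub>R f j) \<bullet> g i))
    = (\<Sum>i\<in>idx qr. poly (lagrange qr i) 1 *\<^sub>R f i) \<bullet> (\<Sum>i\<in>idx qr. poly (lagrange qr i) 1 *\<^sub>R g i)
    - (\<Sum>i\<in>idx qr. poly (lagrange qr i) 0 *\<^sub>R f i) \<bullet> (\<Sum>i\<in>idx qr. poly (lagrange qr i) 0 *\<^sub>R g i)"
    (is "?lhs = ?rhs")
proof -
  have w: "qweight qr i * (D_mat qr i j * c) = A_mat qr i j * c" if "i \<in> idx qr" for i j c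
  proof -
    have "qweight qr i > 0"
      using assms(1) that by (auto simp: valid_quadrature_def)
    then show ?thesis by (simp add: D_mat_def)
  qed
  have "?lhs = (\<Sum>i\<in>idx qr. \<Sum>j\<in>idx qr. A_mat qr i j * (f i \<bullet> g j))
             + (\<Sum>i\<in>idx qr. \<Sum>j\<in>idx qr. A_mat qr i j * (f j \<bullet> g i))"
    by (simp add: distrib_left inner_sum_left inner_sum_right sum_distrib_left sum.distrib w)
  \<comment> \<open>Exchanging the names of the two indices puts the transpose of \<open>A\<close>
    in front of the same inner product as in the first sum.\<close>
  also have "(\<Sum>i\<in>idx qr. \<Sum>j\<in>idx qr. A_mat qr i j * (f j \<bullet> g i))
           = (\<Sum>i\<in>idx qr. \<Sum>j\<in>idx qr. A_mat qr j i * (f i \<bullet> g j))"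
    by (rule sum.swap)
  also have "(\<Sum>i\<in>idx qr. \<Sum>j\<in>idx qr. A_mat qr i j * (f i \<bullet> g j)) + \<dots>
      = (\<Sum>i\<in>idx qr. \<Sum>j\<in>idx qr. (A_mat qr i j + A_mat qr j i) * (f i \<bullet> g j))"
    by (simp add: sum.distrib distrib_right)
  also have "\<dots> = (\<Sum>i\<in>idx qr. \<Sum>j\<in>idx qr.
       (poly (lagrange qr i) 1 * poly (lagrange qr j) 1 - poly (lagrange qr i) 0 * poly (lagrange qr j) 0) * (f i \<bullet> g j))"
    by (intro sum.cong refl) (simp add: A_mat_add_transpose[OF assms(2)])
  also have "\<dots> = ?rhs"
    by (simp add: inner_sum_left inner_sum_right left_diff_distrib sum_subtractf mult.assoc sum_distrib_left mult.left_commute)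
       (subst (1 2) sum.swap, simp add: mult.commute mult.left_commute)
  finally show ?thesis .
qed

section \<open>Tensor-product sums over the nodes\<close>

definition node_weight :: "quadrature \<Rightarrow> nat ^ 3 \<Rightarrow> real" where
  "node_weight qr m = qweight qr (m $ 1) * qweight qr (m $ 2) * qweight qr (m $ 3)"

lemma insert_dir_nth [simp]: "insert_dir \<xi> l \<psi> \<theta> $ \<xi> = l"
  using exhaust_3[of \<xi>] by (auto simp: insert_dir_def)

lemma insert_dir_update:
  "(\<chi> a. if a = \<xi> then l' else insert_dir \<xi> l \<psi> \<theta> $ a) = insert_dir \<xi> l' \<psi> \<theta>"
  using exhaust_3[of \<xi>] by (auto simp: insert_dir_def vec_eq_iff forall_3)

lemma restrict_dir_insert_dir [simp]: "restrict_dir \<xi> g (insert_dir \<xi> l \<psi> \<theta>) = g \<psi> \<theta>"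
  using exhaust_3[of \<xi>] by (auto simp: insert_dir_def restrict_dir_def)

lemma node_weight_insert_dir:
  "node_weight qr (insert_dir \<xi> l \<psi> \<theta>) = qweight qr l * qweight qr \<psi> * qweight qr \<theta>"
  using exhaust_3[of \<xi>] by (auto simp: insert_dir_def node_weight_def)

lemma node_pt_insert_dir: "node_pt qr (insert_dir \<xi> l \<psi> \<theta>) = face_pt qr \<xi> (qnode qr l) \<psi> \<theta>"
  using exhaust_3[of \<xi>] by (auto simp: insert_dir_def face_pt_def node_pt_def vec_eq_iff forall_3)

text \<open>Any direction \<xi> can be made the innermost one, so that one-dimensional identities
  apply along each line of nodes.\<close>

lemma sum_nodes:
  "(\<Sum>m\<in>nodes qr. f m) = (\<Sum>\<psi>\<in>idx qr. \<Sum>\<theta>\<in>idx qr. \<Sum>l\<in>idx qr. f (insert_dir \<xi> l \<psi> \<theta>))"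
proof -
  have "(\<Sum>\<psi>\<in>idx qr. \<Sum>\<theta>\<in>idx qr. \<Sum>l\<in>idx qr. f (insert_dir \<xi> l \<psi> \<theta>))
      = (\<Sum>(\<psi>, \<theta>, l)\<in>(SIGMA _:idx qr. SIGMA _:idx qr. idx qr). f (insert_dir \<xi> l \<psi> \<theta>))"
    by (simp add: sum.Sigma)
  also have "\<dots> = (\<Sum>m\<in>nodes qr. f m)"
    \<comment> \<open>Applied to the pairing function, \<open>restrict_dir\<close> reads the two
      tangential indices off a multi-index, which inverts \<open>insert_dir\<close>.\<close>
    by (rule sum.reindex_bij_witness[where i = "\<lambda>m. restrict_dir \<xi> (\<lambda>\<psi> \<theta>. (\<psi>, \<theta>, m $ \<xi>)) m"
            and j = "\<lambda>(\<psi>, \<theta>, l). insert_dir \<xi> l \<psi> \<theta>"])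
       (use exhaust_3[of \<xi>] in \<open>auto simp: nodes_def forall_3 insert_dir_def restrict_dir_def vec_eq_iff\<close>)
  finally show ?thesis ..
qed

lemma D_op_insert_dir:
  "D_op qr \<xi> f (insert_dir \<xi> l \<psi> \<theta>) = (\<Sum>j\<in>idx qr. D_mat qr l j *\<^sub>R f (insert_dir \<xi> j \<psi> \<theta>))"
  by (simp add: D_op_def insert_dir_update)

text \<open>The tangential weights are constant along a line of nodes in direction \<xi>. The
  one-dimensional identity therefore holds line by line, and the sum over the lines is a face
  sum.\<close>

lemma nodal_summation_by_parts:
  fixes f g :: "'a::real_inner nodal"
  assumes "valid_quadrature qr" "exact_up_to qr (2 * qdeg qr - 1)"
  shows "(\<Sum>m\<in>nodes qr. node_weight qr m * (f m \<bullet> D_op qr \<xi> g m + D_op qr \<xi> f m \<bullet> g m))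
    = face_sum qr (\<lambda>\<psi> \<theta>. face_val qr \<xi> 1 f \<psi> \<theta> \<bullet> face_val qr \<xi> 1 g \<psi> \<theta>)
    - face_sum qr (\<lambda>\<psi> \<theta>. face_val qr \<xi> 0 f \<psi> \<theta> \<bullet> face_val qr \<xi> 0 g \<psi> \<theta>)"
proof -
  have "(\<Sum>l\<in>idx qr. qweight qr l * qweight qr \<psi> * qweight qr \<theta> *
          (f (insert_dir \<xi> l \<psi> \<theta>) \<bullet> (\<Sum>j\<in>idx qr. D_mat qr l j *\<^sub>R g (insert_dir \<xi> j \<psi> \<theta>))
           + (\<Sum>j\<in>idx qr. D_mat qr l j *\<^sub>R f (insert_dir \<xi> j \<psi> \<theta>)) \<bullet> g (insert_dir \<xi> l \<psi> \<theta>)))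
      = (face_val qr \<xi> 1 f \<psi> \<theta> \<bullet> face_val qr \<xi> 1 g \<psi> \<theta>
           - face_val qr \<xi> 0 f \<psi> \<theta> \<bullet> face_val qr \<xi> 0 g \<psi> \<theta>) * qweight qr \<psi> * qweight qr \<theta>" for \<psi> \<theta>
    unfolding face_val_def summation_by_parts[OF assms, symmetric] sum_distrib_right
    by (rule sum.cong) (simp_all add: mult_ac)
  then show ?thesis
    by (simp add: sum_nodes[where \<xi> = \<xi>] D_op_insert_dir node_weight_insert_dir face_sum_def
          left_diff_distrib sum_subtractf)
qed

text \<open>\<open>face_ext\<close> is the adjoint of \<open>face_val\<close>, and
  \<open>H_inv\<close> removes the normal weight, so a lifted face term tested against nodal data
  becomes a face sum.\<close>

lemma nodal_face_pairing:
  fixes f :: "'a::real_inner nodal"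
  assumes "valid_quadrature qr"
  shows "(\<Sum>m\<in>nodes qr. node_weight qr m * (f m \<bullet> H_inv qr \<xi> (face_ext qr \<xi> \<zeta> g) m))
    = face_sum qr (\<lambda>\<psi> \<theta>. face_val qr \<xi> \<zeta> f \<psi> \<theta> \<bullet> g \<psi> \<theta>)"
proof -
  have "qweight qr l \<noteq> 0" if "l \<in> idx qr" for l
    using assms that by (force simp: valid_quadrature_def)
  then have "(\<Sum>l\<in>idx qr. qweight qr l * qweight qr \<psi> * qweight qr \<theta> *
        (f (insert_dir \<xi> l \<psi> \<theta>) \<bullet> H_inv qr \<xi> (face_ext qr \<xi> \<zeta> g) (insert_dir \<xi> l \<psi> \<theta>)))
      = face_val qr \<xi> \<zeta> f \<psi> \<theta> \<bullet> g \<psi> \<theta> * qweight qr \<psi> * qweight qr \<theta>" for \<psi> \<theta>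
    by (simp add: H_inv_def face_ext_def face_val_def inner_sum_left sum_distrib_left
          mult_ac cong: sum.cong)
  then show ?thesis
    by (simp add: sum_nodes[where \<xi> = \<xi>] node_weight_insert_dir face_sum_def)
qed

lemma face_val_at_node:
  fixes f :: "'a::real_vector nodal"
  assumes "valid_quadrature qr" "i \<in> idx qr"
  shows "face_val qr \<xi> (qnode qr i) f \<psi> \<theta> = f (insert_dir \<xi> i \<psi> \<theta>)"
proof -
  have "face_val qr \<xi> (qnode qr i) f \<psi> \<theta>
      = (\<Sum>l\<in>idx qr. if l = i then f (insert_dir \<xi> l \<psi> \<theta>) else 0)"
    unfolding face_val_def using assms
    by (intro sum.cong refl) (auto simp: poly_lagrange_node valid_quadrature_def)
  then show ?thesis using assms(2) by simp
qed

section \<open>States and fluxes\<close>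

text \<open>The stresses that form the matrix \<open>stress Q\<close>, kept as a vector to be paired
  with \<open>voigt\<close>.\<close>

definition stress_vec :: "state \<Rightarrow> real^6" where
  "stress_vec Q = (\<chi> b. Q $ Inr b)"

lemma inner_pack: "Q \<bullet> pack u w = vel Q \<bullet> u + stress_vec Q \<bullet> w"
proof -
  have U: "(UNIV :: (3 + 6) set) = range Inl \<union> range Inr" by (rule UNIV_sum)
  have "(\<Sum>i\<in>UNIV. Q $ i * pack u w $ i)
      = (\<Sum>i\<in>range Inl. Q $ i * pack u w $ i) + (\<Sum>i\<in>range Inr. Q $ i * pack u w $ i)"
    unfolding U by (rule sum.union_disjoint) auto
  then show ?thesis
    by (simp add: inner_vec_def sum.reindex pack_def vel_def stress_vec_def)
qed

lemma exhaust_6: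
  fixes x :: 6
  shows "x = 1 \<or> x = 2 \<or> x = 3 \<or> x = 4 \<or> x = 5 \<or> x = 6"
proof (induct x)
  case (of_int z)
  \<comment> \<open>The index type consists of residues modulo 6, so the representative 0 is the
    index 6.\<close>
  then have "z = 0 \<or> z = 1 \<or> z = 2 \<or> z = 3 \<or> z = 4 \<or> z = 5" by auto
  then show ?case by auto
qed

lemma sum_6: "sum f (UNIV :: 6 set) = f 1 + f 2 + f 3 + f 4 + f 5 + f 6"
proof -
  have U: "(UNIV :: 6 set) = {1, 2, 3, 4, 5, 6}"
    using exhaust_6 by auto
  show ?thesis unfolding U by (simp add: ac_simps)
qed

lemma vector_6:
  "(vector [a, b, c, d, e, f] :: 'a::zero^6) $ 1 = a"
  "(vector [a, b, c, d, e, f] :: 'a::zero^6) $ 2 = b"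
  "(vector [a, b, c, d, e, f] :: 'a::zero^6) $ 3 = c"
  "(vector [a, b, c, d, e, f] :: 'a::zero^6) $ 4 = d"
  "(vector [a, b, c, d, e, f] :: 'a::zero^6) $ 5 = e"
  "(vector [a, b, c, d, e, f] :: 'a::zero^6) $ 6 = f"
  unfolding vector_def by simp_all

text \<open>Each shear stress occurs twice in the symmetric matrix, and each shear entry of
  \<open>voigt\<close> is the sum of the two corresponding products. This duality links the
  non-conservative terms to the flux.\<close>

lemma stress_vec_voigt: "stress_vec Q \<bullet> voigt g u = (stress Q *v g) \<bullet> u"
  by (simp add: inner_vec_def sum_3 sum_6 vector_6 stress_vec_def voigt_def stress_def
        matrix_vector_mult_def algebra_simps)

lemma vel_sum_scaleR: "vel (\<Sum>i\<in>S. c i *\<^sub>R Q i) = (\<Sum>i\<in>S. c i *\<^sub>R vel (Q i))"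
  by (simp add: vel_def vec_eq_iff)

lemma vel_face_val: "vel (face_val qr \<xi> \<zeta> Q \<psi> \<theta>) = face_val qr \<xi> \<zeta> (\<lambda>m. vel (Q m)) \<psi> \<theta>"
  by (simp add: face_val_def vel_sum_scaleR)

lemma vel_D_op: "vel (D_op qr \<xi> Q m) = D_op qr \<xi> (\<lambda>m. vel (Q m)) m"
  by (simp add: D_op_def vel_sum_scaleR)

lemma vel_pack [simp]: "vel (pack u w) = u"
  by (simp add: vel_def pack_def)

lemma F_nodal_eq: "F_nodal qr E \<xi> Q m = pack (vel (F_nodal qr E \<xi> Q m)) 0"
  by (simp add: F_nodal_def flux_F_def)

lemma inner_D_op_F_nodal:
  "Q m \<bullet> D_op qr \<xi> (F_nodal qr E \<xi> Q) m = vel (Q m) \<bullet> D_op qr \<xi> (\<lambda>m. vel (F_nodal qr E \<xi> Q m)) m"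
  by (subst D_op_def, subst F_nodal_eq) (simp add: D_op_def inner_sum_right inner_pack)

text \<open>Together with \<open>inner_D_op_F_nodal\<close> this shows that both volume terms
  involve only the velocity and the velocity part of the flux, as the two halves of a summation by
  parts.\<close>

lemma inner_flux_B:
  "Q m \<bullet> flux_B E \<xi> (node_pt qr m) dQ = vel (F_nodal qr E \<xi> Q m) \<bullet> vel dQ"
  by (simp add: flux_B_def inner_pack stress_vec_voigt F_nodal_def flux_F_def)

text \<open>Moving the transposed rotation to the other factor expresses the pairing in local
  components, and \<open>stress_vec_voigt\<close> produces the traction of the stress in
  \<open>Q\<close>. The tested state \<open>Q\<close> is kept apart from the nodal data
  \<open>U\<close>, because it will be a face value of the interpolant.\<close>

lemma inner_FLR:
  assumes "\<zeta> \<in> {0, 1}" "p = face_pt qr \<xi> \<zeta> \<psi> \<theta>" "R = rot E \<xi> \<zeta> p" "G = fluct qr E U vh Th \<xi> \<zeta> \<psi> \<theta>"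
  shows "Q \<bullet> FLR qr E U vh Th \<xi> \<zeta> \<psi> \<theta> =
    (\<Sum>\<eta>\<in>UNIV. (R *v vel Q) $ \<eta> * G $ \<eta>
      + (if \<zeta> = 1 then 1 else -1) * (R *v (stress Q *v normal E \<xi> p)) $ \<eta> * (G $ \<eta> / impedance E \<xi> p $ \<eta>))"
proof -
  have adj: "x \<bullet> (y v* S) = (S *v x) \<bullet> y" for x y :: "real^3" and S
    by (metis dot_lmul_matrix inner_commute)
  have "Q \<bullet> FLR qr E U vh Th \<xi> \<zeta> \<psi> \<theta> = (R *v vel Q) \<bullet> G
      + (if \<zeta> = 1 then 1 else -1) * ((R *v (stress Q *v normal E \<xi> p)) \<bullet> (\<chi> \<eta>. G $ \<eta> / impedance E \<xi> p $ \<eta>))"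
    using assms(1) unfolding assms(2-4)
    by (auto simp: FLR_def Let_def inner_pack stress_vec_voigt fluct_xyz_def fluct_tilde_xyz_def
        adj)
  then show ?thesis
    by (simp add: inner_vec_def sum.distrib sum_distrib_left mult.assoc)
qed

section \<open>Pointwise identities on faces\<close>

lemma orthogonal_frame:
  assumes "norm n = 1" "norm m = 1" "n \<bullet> m = 0"
  shows "orthogonal_matrix (vector [n, m, cross3 n m] :: real^3^3)"
proof -
  \<comment> \<open>Lagrange's identity makes the squared norm equal to 1, and nonnegativity
    excludes the root -1.\<close>
  have "norm (cross3 n m) = 1"
    using norm_cross_dot[of n m] norm_ge_zero[of "cross3 n m"] assms
    by (auto simp: power2_eq_1_iff simp del: norm_ge_zero)
  then show ?thesis
    using assms
    by (simp add: orthogonal_matrix_orthonormal_rows row_def forall_3 orthogonal_def dot_cross_self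
          inner_commute[of m n])
qed

text \<open>Keeping \<open>Z * v - T\<close> forces the jump of the traction to be \<open>Z\<close>
  times the jump \<open>d\<close> of the velocity. Hence \<open>G = Z * d\<close>, and the claim is
  a polynomial identity in \<open>vh\<close>, \<open>T\<close>, \<open>Z\<close> and
  \<open>d\<close>.\<close>

lemma hat_identity_right:
  fixes Z v T vh Th :: real
  assumes "Z > 0" "Z * vh - Th = 2 * ((Z * v - T) / 2)" "G = Z * (v - vh) / 2 + (T - Th) / 2"
  shows "v * T - (v * G + T * (G / Z)) = Th * vh - 1 / Z * G\<^sup>2"
proof -
  define d where "d = v - vh"
  have Th: "Th = T - Z * d" and v: "v = vh + d" using assms(2) by (simp_all add: d_def algebra_simps)
  then have G: "G = Z * d" using assms(3) by simp
  show ?thesis using assms(1) unfolding G Th v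
    by (simp add: algebra_simps power2_eq_square)
qed

text \<open>The mirror image of \<open>hat_identity_right\<close> under a change of sign of both
  tractions.\<close>

lemma hat_identity_left:
  fixes Z v T vh Th :: real
  assumes "Z > 0" "Z * vh + Th = 2 * ((Z * v + T) / 2)" "G = Z * (v - vh) / 2 - (T - Th) / 2"
  shows "- (v * T) - (v * G - T * (G / Z)) = - (Th * vh) - 1 / Z * G\<^sup>2"
proof -
  define d where "d = v - vh"
  have Th: "Th = T + Z * d" and v: "v = vh + d" using assms(2) by (simp_all add: d_def algebra_simps)
  then have G: "G = Z * d" using assms(3) by simp
  show ?thesis using assms(1) unfolding G Th v
    by (simp add: algebra_simps power2_eq_square)
qed

section \<open>Geometry of an element\<close>

lemma matrix_inv_mult:
  fixes A :: "real^'n^'n"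
  assumes "invertible A"
  shows "matrix_inv A ** A = mat 1" "A ** matrix_inv A = mat 1"
  using assms someI_ex[of "\<lambda>B. A ** B = mat 1 \<and> B ** A = mat 1"]
  by (auto simp: invertible_def matrix_inv_def)

lemma ref_cube_eq: "ref_cube = cbox 0 (vec 1)"
  by (auto simp: ref_cube_def mem_box_cart)

lemma emap_has_derivative:
  assumes "valid_element E" "p \<in> ref_cube"
  shows "(emap E has_derivative (\<lambda>h. jacobian (emap E) (at p within ref_cube) *v h)) (at p within ref_cube)"
proof -
  have "Ck_on (Suc 0) (emap E) ref_cube"
    using assms(1) by (simp only: valid_element_def smooth_on_def)
  then show ?thesis
    using assms(2) by (auto simp: differentiable_def simp flip: jacobian_works)
qed

text \<open>The matrix behind \<open>grad\<close> is a chosen derivative within the image of the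
  cube. Differentiability of the inverse map makes it a genuine derivative; the chain rule for the
  composition with \<open>emap E\<close> then identifies the product.\<close>

lemma jacobian_inverse_mult:
  assumes "valid_element E" "p \<in> ref_cube"
  shows "jacobian (inv_into ref_cube (emap E)) (at (emap E p) within emap E ` ref_cube)
           ** jacobian (emap E) (at p within ref_cube) = mat 1"
proof -
  let ?g = "inv_into ref_cube (emap E)"
  define A where "A = jacobian (emap E) (at p within ref_cube)"
  define G where "G = jacobian ?g (at (emap E p) within emap E ` ref_cube)"
  have inj: "inj_on (emap E) ref_cube" using assms(1) by (simp add: valid_element_def)
  have dA: "(emap E has_derivative (\<lambda>h. A *v h)) (at p within ref_cube)"
    unfolding A_def by (rule emap_has_derivative[OF assms])
  have "invertible A"
    using assms by (force simp: valid_element_def Jac_def A_def invertible_det_nz)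
  then have inv: "matrix_inv A ** A = mat 1"
    by (simp add: matrix_inv_mult)
  have "Ck_on 0 (emap E) ref_cube"
    using assms(1) by (simp only: valid_element_def smooth_on_def)
  \<comment> \<open>The cube is compact, so a continuous injection on it has a continuous
    inverse.\<close>
  then have "continuous_on (emap E ` ref_cube) ?g"
    using inj by (intro continuous_on_inv) (auto simp: ref_cube_eq)
  then have cont: "continuous (at (emap E p) within emap E ` ref_cube) ?g"
    using assms(2) by (simp add: continuous_on_eq_continuous_within)
  have "(?g has_derivative (\<lambda>h. matrix_inv A *v h)) (at (emap E p) within emap E ` ref_cube)"
    by (rule has_derivative_inverse_within[OF dA cont assms(2)])
       (use inj in \<open>auto simp: o_def matrix_vector_mul_assoc inv fun_eq_iff\<close>)
  then have "(?g has_derivative (\<lambda>h. G *v h)) (at (emap E p) within emap E ` ref_cube)"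
    unfolding G_def by (auto simp: differentiable_def simp flip: jacobian_works)
  from diff_chain_within[OF dA this]
  have "((\<lambda>x. ?g (emap E x)) has_derivative (\<lambda>h. (G ** A) *v h)) (at p within ref_cube)"
    by (simp add: o_def matrix_vector_mul_assoc)
  then have "((\<lambda>x. x) has_derivative (\<lambda>h. (G ** A) *v h)) (at p within ref_cube)"
    by (rule has_derivative_transform[OF assms(2), rotated]) (simp add: inj)
  moreover have "((\<lambda>x. x) has_derivative (\<lambda>h. h)) (at p within ref_cube)"
    by (rule has_derivative_ident)
  \<comment> \<open>Derivatives within a nondegenerate box are unique, also at its boundary
    points.\<close>
  ultimately have "(\<lambda>h. (G ** A) *v h) = (\<lambda>h. h)"
    using assms(2) unfolding ref_cube_eq
    by (intro frechet_derivative_unique_within_closed_interval[of 0 "vec 1" p])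
       (auto simp: Basis_vec_def inner_axis)
  then have "G ** A = mat 1"
    by (simp add: matrix_eq fun_eq_iff)
  then show ?thesis by (simp add: A_def G_def)
qed

text \<open>The gradients of the reference coordinates are the basis dual to the tangent vectors,
  the columns of the Jacobian matrix.\<close>

lemma inner_grad_column:
  assumes "valid_element E" "p \<in> ref_cube"
  shows "grad E \<xi> p \<bullet> column k (jacobian (emap E) (at p within ref_cube)) = (if \<xi> = k then 1 else 0)"
proof -
  have "(jacobian (inv_into ref_cube (emap E)) (at (emap E p) within emap E ` ref_cube)
           ** jacobian (emap E) (at p within ref_cube)) $ \<xi> $ k = mat 1 $ \<xi> $ k"
    by (simp only: jacobian_inverse_mult[OF assms])
  then show ?thesis
    by (simp add: matrix_matrix_mult_def inner_vec_def column_def grad_def mat_def)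
qed

lemma grad_nonzero:
  assumes "valid_element E" "p \<in> ref_cube"
  shows "grad E \<xi> p \<noteq> 0"
  using inner_grad_column[OF assms, of \<xi> \<xi>] by auto

text \<open>
  Only derivatives tangential to the faces \<open>q = const\<close> occur on the right, and these are shared by two
  maps that agree on a face.
\<close>

lemma Jac_grad_1_eq_cross:
  assumes "valid_element E" "p \<in> ref_cube"
  defines "A \<equiv> jacobian (emap E) (at p within ref_cube)"
  shows "Jac E p *\<^sub>R grad E 1 p = cross3 (column 2 A) (column 3 A)"
proof -
  define w where "w = Jac E p *\<^sub>R grad E 1 p - cross3 (column 2 A) (column 3 A)"
  have A: "invertible A"
    using assms(1,2) by (force simp: valid_element_def Jac_def A_def invertible_det_nz)
  have "column 1 A \<bullet> cross3 (column 2 A) (column 3 A) = det A"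
    by (simp add: cross3_simps column_def)
  \<comment> \<open>Both vectors have inner products \<open>det A\<close>, 0, 0 with the three
    columns. Since \<open>A\<close> is invertible, their difference, orthogonal to every column,
    must vanish.\<close>
  then have "w \<bullet> column k A = 0" for k
    using exhaust_3[of k] inner_grad_column[OF assms(1,2), of 1 k, folded A_def]
    by (auto simp: w_def inner_diff_left dot_cross_self Jac_def A_def[symmetric]
          inner_commute[of "cross3 _ _"])
  then have "w v* A = 0"
    by (simp add: vector_matrix_mult_def vec_eq_iff inner_vec_def column_def mult.commute)
  then have "w v* (A ** matrix_inv A) = 0"
    by (simp flip: vector_matrix_mul_assoc)
  then show ?thesis
    using A by (simp add: matrix_inv_mult w_def)
qed

text \<open>A column of the Jacobian matrix is a partial derivative along a segment inside the cube,
  one-sided at its ends. It is thus determined by the values of the map on that segment.\<close>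

lemma emap_partial_derivative:
  assumes "valid_element E" "p \<in> ref_cube"
  shows "((\<lambda>t. emap E (\<chi> i. if i = k then t else p $ i)) has_vector_derivative
            column k (jacobian (emap E) (at p within ref_cube))) (at (p $ k) within {0..1})"
proof -
  let ?\<gamma> = "\<lambda>t. \<chi> i. if i = k then t else p $ i"
  have \<gamma>: "?\<gamma> = (\<lambda>t. p + (t - p $ k) *\<^sub>R axis k 1)"
    by (auto simp: fun_eq_iff vec_eq_iff axis_def)
  have "(?\<gamma> has_derivative (\<lambda>h. h *\<^sub>R axis k 1)) (at (p $ k) within {0..1})"
    unfolding \<gamma> by (auto intro!: derivative_eq_intros)
  moreover have "?\<gamma> ` {0..1} \<subseteq> ref_cube" "?\<gamma> (p $ k) = p"
    using assms(2) by (auto simp: ref_cube_def vec_eq_iff)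
  ultimately have "((\<lambda>t. emap E (?\<gamma> t)) has_derivative
      (\<lambda>h. jacobian (emap E) (at p within ref_cube) *v (h *\<^sub>R axis k 1))) (at (p $ k) within {0..1})"
    using has_derivative_in_compose2[of ref_cube "emap E" "\<lambda>x h. jacobian (emap E) (at x within ref_cube) *v h"
        ?\<gamma> "{0..1}" "p $ k"] emap_has_derivative[OF assms(1)] assms(2)
    by (auto simp: ref_cube_def)
  then show ?thesis
    by (simp add: has_vector_derivative_def matrix_vector_mult_scaleR matrix_vector_mult_basis)
qed

text \<open>The two maps agree along segments in the \<open>r\<close> and \<open>s\<close>
  directions of the interface, so columns 2 and 3 of their Jacobian matrices agree, and the cross
  product formula uses no others. The derivatives across the interface may differ.\<close>

lemma Jac_grad_interface:
  assumes "valid_element Em" "valid_element Ep" "common_interface Em Ep" "a \<in> {0..1}" "b \<in> {0..1}"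
  shows "Jac Em (insert_dir 1 1 a b) *\<^sub>R grad Em 1 (insert_dir 1 1 a b)
       = Jac Ep (insert_dir 1 0 a b) *\<^sub>R grad Ep 1 (insert_dir 1 0 a b)"
proof -
  let ?pm = "insert_dir 1 1 a b :: real^3" and ?pp = "insert_dir 1 0 a b :: real^3"
  have p: "?pm \<in> ref_cube" "?pp \<in> ref_cube"
    using assms(4,5) by (auto simp: ref_cube_def insert_dir_def forall_3)
  have eq: "emap Em (\<chi> i. if i = k then t else ?pm $ i) = emap Ep (\<chi> i. if i = k then t else ?pp $ i)"
    if "k \<in> {2, 3}" "t \<in> {0..1}" for k :: 3 and t
  proof -
    \<comment> \<open>The face coordinates after the coordinate \<open>k\<close> has been moved to
      \<open>t\<close>; the point stays on the interface.\<close>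
    define u v where "u = (if k = 2 then t else a)" and "v = (if k = 3 then t else b)"
    have "(\<chi> i. if i = k then t else insert_dir 1 \<zeta> a b $ i) = insert_dir 1 \<zeta> u v" for \<zeta> :: real
      using that(1) by (auto simp: vec_eq_iff forall_3 insert_dir_def u_def v_def)
    moreover have "u \<in> {0..1}" "v \<in> {0..1}" using that assms(4,5) by (auto simp: u_def v_def)
    ultimately show ?thesis
      using assms(3) by (auto simp: common_interface_def)
  qed
  have "column k (jacobian (emap Em) (at ?pm within ref_cube)) = column k (jacobian (emap Ep) (at ?pp within ref_cube))"
    if k: "k \<in> {2, 3}" for k :: 3
  proof -
    have k': "?pm $ k = ?pp $ k" "?pp $ k \<in> {0..1}"
      using k assms(4,5) by (auto simp: insert_dir_def)
    have "((\<lambda>t. emap Ep (\<chi> i. if i = k then t else ?pp $ i)) has_vector_derivative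
            column k (jacobian (emap Em) (at ?pm within ref_cube))) (at (?pp $ k) within {0..1})"
      using k' by (intro has_vector_derivative_transform[OF _ _
            emap_partial_derivative[OF assms(1) p(1), of k, unfolded k']]) (auto simp: eq[OF k])
    then show ?thesis
      using emap_partial_derivative[OF assms(2) p(2), of k] k'
      by (intro vector_derivative_unique_within_closed_interval[of 0 1]) auto
  qed
  then show ?thesis
    by (simp add: Jac_grad_1_eq_cross[OF assms(1) p(1)] Jac_grad_1_eq_cross[OF assms(2) p(2)])
qed

lemma surf_interface:
  assumes "valid_element Em" "valid_element Ep" "common_interface Em Ep" "a \<in> {0..1}" "b \<in> {0..1}"
  shows "surf Em 1 (insert_dir 1 1 a b) = surf Ep 1 (insert_dir 1 0 a b)"
proof -
  have p: "insert_dir 1 1 a b \<in> ref_cube" "insert_dir 1 0 a b \<in> ref_cube"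
    using assms(4,5) by (auto simp: ref_cube_def insert_dir_def forall_3)
  then have "Jac Em (insert_dir 1 1 a b) > 0" "Jac Ep (insert_dir 1 0 a b) > 0"
    using assms(1,2) by (auto simp: valid_element_def)
  then show ?thesis
    using arg_cong[OF Jac_grad_interface[OF assms], of norm] by (simp add: surf_def)
qed

section \<open>Positivity and symmetry of the coefficients\<close>

lemma face_pt_in_ref_cube:
  assumes "valid_quadrature qr" "\<zeta> \<in> {0..1}" "\<psi> \<in> idx qr" "\<theta> \<in> idx qr"
  shows "face_pt qr \<xi> \<zeta> \<psi> \<theta> \<in> ref_cube"
  using assms exhaust_3[of \<xi>]
  by (auto simp: face_pt_def insert_dir_def ref_cube_def forall_3 valid_quadrature_def)

lemma node_pt_in_ref_cube:
  assumes "valid_quadrature qr" "m \<in> nodes qr"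
  shows "node_pt qr m \<in> ref_cube"
  using assms by (auto simp: node_pt_def ref_cube_def nodes_def valid_quadrature_def)

lemma surf_pos: "valid_element E \<Longrightarrow> p \<in> ref_cube \<Longrightarrow> surf E \<xi> p > 0"
  using grad_nonzero by (auto simp: surf_def valid_element_def)

lemma impedance_pos:
  assumes "valid_element E" "p \<in> ref_cube"
  shows "impedance E \<xi> p $ \<eta> > 0"
proof -
  \<comment> \<open>Some components of the normal may vanish, but one that does not is enough,
    because the speeds are positive along every axis.\<close>
  obtain a where a: "normal E \<xi> p $ a \<noteq> 0"
    using grad_nonzero[OF assms, of \<xi>] by (auto simp: vec_eq_iff normal_def)
  have pos: "sqrt (\<Sum>a\<in>UNIV. (normal E \<xi> p $ a * s $ a)\<^sup>2) > 0" if "\<forall>a. s $ a > 0" for s :: "real^3"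
  proof -
    have "s $ a \<noteq> 0" using that by (metis less_irrefl)
    then have "(\<Sum>a\<in>UNIV. (normal E \<xi> p $ a * s $ a)\<^sup>2) > 0"
      using a by (intro sum_pos2[of _ a]) simp_all
    then show ?thesis by simp
  qed
  have "emap E p \<in> emap E ` ref_cube" using assms(2) by simp
  then have "density E (emap E p) > 0" "\<forall>a. speed_p E (emap E p) $ a > 0"
    "\<forall>a. speed_sh E (emap E p) $ a > 0" "\<forall>a. speed_sv E (emap E p) $ a > 0"
    using assms(1) unfolding valid_element_def by blast+
  then show ?thesis
    using exhaust_3[of \<eta>] pos by (auto simp only: impedance_def Let_def vector_3 vector_scaleR_component
       real_scaleR_def intro!: mult_pos_pos)
qed

lemma P_mat_mult_vec:
  "P_mat E p *v x = pack ((1 / density E (emap E p)) *\<^sub>R vel x) (stiffness E (emap E p) *v stress_vec x)"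
proof -
  have U: "(UNIV :: (3 + 6) set) = range Inl \<union> range Inr" by (rule UNIV_sum)
  have "sum f UNIV = (\<Sum>a\<in>UNIV. f (Inl a)) + (\<Sum>b\<in>UNIV. f (Inr b))" for f :: "3 + 6 \<Rightarrow> real"
    unfolding U by (subst sum.union_disjoint) (auto simp: sum.reindex)
  then show ?thesis
    by (auto simp: vec_eq_iff matrix_vector_mult_def P_mat_def pack_def vel_def stress_vec_def
          if_distrib[of "\<lambda>c. c * _"] cong: if_cong split: sum.split)
qed

lemma matrix_inv_symmetric:
  fixes A :: "real^'n^'n"
  assumes "transpose A = A" "invertible A"
  shows "transpose (matrix_inv A) = matrix_inv A"
proof -
  have "transpose (matrix_inv A) ** A = mat 1"
    using matrix_inv_mult[OF assms(2)]
    by (metis assms(1) matrix_transpose_mul transpose_mat)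
  then show ?thesis
    by (metis matrix_inv_mult(2)[OF assms(2)] matrix_mul_assoc matrix_mul_lid matrix_mul_rid)
qed

text \<open>Symmetry lets the two terms of the differentiated quadratic energy coincide.
  Invertibility follows from a trivial kernel, block by block: positive density for the velocity,
  positive definite stiffness for the stress.\<close>

lemma P_tilde_inv_symmetric:
  assumes "valid_element E" "p \<in> ref_cube"
  shows "transpose (matrix_inv (P_tilde E p)) = matrix_inv (P_tilde E p)"
proof (rule matrix_inv_symmetric)
  have J: "Jac E p > 0" and \<rho>: "density E (emap E p) > 0" and C: "sym_pos_def (stiffness E (emap E p))"
    using assms by (auto simp: valid_element_def)
  have "stiffness E (emap E p) $ a $ b = stiffness E (emap E p) $ b $ a" for a b
  proof -
    have "transpose (stiffness E (emap E p)) $ a $ b = stiffness E (emap E p) $ a $ b"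
      using C by (simp add: sym_pos_def_def)
    then show ?thesis by (simp add: transpose_def)
  qed
  then have "transpose (P_mat E p) $ i $ j = P_mat E p $ i $ j" for i j
    by (cases i; cases j) (simp_all add: transpose_def P_mat_def)
  then have "transpose (P_mat E p) = P_mat E p"
    by (simp add: vec_eq_iff)
  then show "transpose (P_tilde E p) = P_tilde E p"
    by (simp add: P_tilde_def transpose_scalar)
  have "x = 0" if "P_tilde E p *v x = 0" for x
  proof -
    have "P_mat E p *v x = 0"
      using that J by (simp add: P_tilde_def scaleR_matrix_vector_assoc[symmetric])
    then have "pack ((1 / density E (emap E p)) *\<^sub>R vel x) (stiffness E (emap E p) *v stress_vec x) = 0"
      by (simp only: P_mat_mult_vec)
    then have "vel x = 0" "stiffness E (emap E p) *v stress_vec x = 0"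
      using \<rho> by (auto simp: pack_def vec_eq_iff split: sum.splits)
    then have "vel x = 0" "stress_vec x = 0"
      using C by (auto simp: sym_pos_def_def)
    then have "x $ i = 0" for i
      by (cases i) (simp_all add: vec_eq_iff vel_def stress_vec_def)
    then show "x = 0"
      by (simp add: vec_eq_iff)
  qed
  then show "invertible (P_tilde E p)"
    by (simp add: invertible_left_inverse matrix_left_invertible_ker)
qed

section \<open>Energy balance of one element\<close>

lemma face_sum_cong:
  "(\<And>\<psi> \<theta>. \<psi> \<in> idx qr \<Longrightarrow> \<theta> \<in> idx qr \<Longrightarrow> f \<psi> \<theta> = g \<psi> \<theta>) \<Longrightarrow> face_sum qr f = face_sum qr g"
  by (simp add: face_sum_def cong: sum.cong)

lemma face_sum_diff: "face_sum qr (\<lambda>\<psi> \<theta>. f \<psi> \<theta> - g \<psi> \<theta>) = face_sum qr f - face_sum qr g"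
  by (simp add: face_sum_def left_diff_distrib sum_subtractf)

lemma face_sum_uminus: "face_sum qr (\<lambda>\<psi> \<theta>. - f \<psi> \<theta>) = - face_sum qr f"
  by (simp add: face_sum_def sum_negf)

lemma face_sum_nonneg:
  assumes "valid_quadrature qr" "\<And>\<psi> \<theta>. \<psi> \<in> idx qr \<Longrightarrow> \<theta> \<in> idx qr \<Longrightarrow> f \<psi> \<theta> \<ge> 0"
  shows "face_sum qr f \<ge> 0"
  using assms unfolding face_sum_def valid_quadrature_def
  by (intro sum_nonneg mult_nonneg_nonneg) (auto intro: less_imp_le)

lemma face_val_F_nodal:
  assumes "valid_quadrature qr" "valid_element E" "\<zeta> \<in> {0, 1}" "\<psi> \<in> idx qr" "\<theta> \<in> idx qr"
  shows "vel (face_val qr \<xi> \<zeta> (F_nodal qr E \<xi> Q) \<psi> \<theta>)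
       = surf E \<xi> (face_pt qr \<xi> \<zeta> \<psi> \<theta>) *\<^sub>R face_traction qr E Q \<xi> \<zeta> \<psi> \<theta>"
proof -
  have "face_pt qr \<xi> \<zeta> \<psi> \<theta> \<in> ref_cube"
    using face_pt_in_ref_cube[OF assms(1) _ assms(4,5)] assms(3) by auto
  then show ?thesis
    using surf_pos[OF assms(2), of _ \<xi>] by (force simp: face_traction_def)
qed

text \<open>On a face containing nodes interpolation is evaluation, and the nodal flux is the
  traction times the surface factor. On any other face \<open>traction_compatible\<close> supplies
  the identity.\<close>

lemma face_traction_eq_stress_normal:
  assumes "valid_quadrature qr" "valid_element E" "traction_compatible qr E Q"
    and "\<zeta> \<in> {0, 1}" "\<psi> \<in> idx qr" "\<theta> \<in> idx qr"
  shows "face_traction qr E Q \<xi> \<zeta> \<psi> \<theta>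
       = stress (face_val qr \<xi> \<zeta> Q \<psi> \<theta>) *v normal E \<xi> (face_pt qr \<xi> \<zeta> \<psi> \<theta>)"
proof (cases "\<zeta> \<in> qnode qr ` idx qr")
  case False
  then show ?thesis using assms by (auto simp: traction_compatible_def)
next
  case True
  then obtain i where i: "i \<in> idx qr" "\<zeta> = qnode qr i" by auto
  have "face_pt qr \<xi> \<zeta> \<psi> \<theta> \<in> ref_cube"
    using face_pt_in_ref_cube[OF assms(1) _ assms(5,6)] assms(4) by auto
  then have "Jac E (face_pt qr \<xi> \<zeta> \<psi> \<theta>) \<noteq> 0"
    using assms(2) by (force simp: valid_element_def)
  then show ?thesis
    using i assms(1)
    by (simp add: face_traction_def face_val_at_node F_nodal_def flux_F_def node_pt_insert_dir surf_def
          normal_def matrix_vector_mult_scaleR)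
qed

lemma rot_inner:
  assumes "valid_element E" "p \<in> ref_cube" "\<zeta> \<in> {0, 1}" "p $ \<xi> = \<zeta>"
  shows "(rot E \<xi> \<zeta> p *v x) \<bullet> (rot E \<xi> \<zeta> p *v y) = x \<bullet> y"
proof -
  have "norm (normal E \<xi> p) = 1"
    using grad_nonzero[OF assms(1,2)] by (simp add: normal_def)
  moreover have "norm (tangent E \<xi> \<zeta> p) = 1" "normal E \<xi> p \<bullet> tangent E \<xi> \<zeta> p = 0"
    using assms unfolding valid_element_def by blast+
  ultimately have "orthogonal_matrix (rot E \<xi> \<zeta> p)"
    unfolding rot_def by (rule orthogonal_frame)
  then have "transpose (rot E \<xi> \<zeta> p) ** rot E \<xi> \<zeta> p = mat 1"
    by (simp add: orthogonal_matrix)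
  then show ?thesis
    by (metis dot_lmul_matrix matrix_vector_mul_assoc matrix_vector_mul_lid transpose_matrix_vector inner_commute)
qed

text \<open>
  The hat-variables keep the characteristic that leaves the element through the face:
  \<open>q\<close> at \<open>\<zeta> = 0\<close> and \<open>p\<close> at \<open>\<zeta> = 1\<close>. The energy balance needs nothing else from them.
\<close>

definition hat_compatible ::
  "quadrature \<Rightarrow> element \<Rightarrow> state nodal \<Rightarrow> (real^3) facefield \<Rightarrow> (real^3) facefield \<Rightarrow> bool" where
  "hat_compatible qr E Q vh Th \<longleftrightarrow> (\<forall>\<xi>. \<forall>\<psi>\<in>idx qr. \<forall>\<theta>\<in>idx qr. \<forall>\<eta>.
     impedance E \<xi> (face_pt qr \<xi> 0 \<psi> \<theta>) $ \<eta> * vh \<xi> 0 \<psi> \<theta> $ \<eta> + Th \<xi> 0 \<psi> \<theta> $ \<eta>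
       = 2 * char_q qr E Q \<xi> 0 \<psi> \<theta> $ \<eta> \<and>
     impedance E \<xi> (face_pt qr \<xi> 1 \<psi> \<theta>) $ \<eta> * vh \<xi> 1 \<psi> \<theta> $ \<eta> - Th \<xi> 1 \<psi> \<theta> $ \<eta>
       = 2 * char_p qr E Q \<xi> 1 \<psi> \<theta> $ \<eta>)"

text \<open>The sign \<open>s\<close> is the orientation of the outward normal relative to direction
  \<xi>. In local components the claim decouples over \<eta> into the scalar hat identities,
  multiplied by the surface factor.\<close>

lemma face_balance:
  fixes \<xi> :: 3
  assumes "valid_quadrature qr" "valid_element E" "traction_compatible qr E Q" "hat_compatible qr E Q vh Th"
    and \<zeta>: "\<zeta> \<in> {0, 1}" and idx: "\<psi> \<in> idx qr" "\<theta> \<in> idx qr"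
  defines "s \<equiv> if \<zeta> = 1 then 1 else -1" and "p \<equiv> face_pt qr \<xi> \<zeta> \<psi> \<theta>"
  shows "s * (face_val qr \<xi> \<zeta> (\<lambda>m. vel (Q m)) \<psi> \<theta> \<bullet> face_val qr \<xi> \<zeta> (\<lambda>m. vel (F_nodal qr E \<xi> Q m)) \<psi> \<theta>)
         - face_val qr \<xi> \<zeta> Q \<psi> \<theta> \<bullet> (surf E \<xi> p *\<^sub>R FLR qr E Q vh Th \<xi> \<zeta> \<psi> \<theta>)
       = s * (surf E \<xi> p * (\<Sum>\<eta>\<in>UNIV. Th \<xi> \<zeta> \<psi> \<theta> $ \<eta> * vh \<xi> \<zeta> \<psi> \<theta> $ \<eta>))
         - surf E \<xi> p * (\<Sum>\<eta>\<in>UNIV. 1 / impedance E \<xi> p $ \<eta> * \<bar>fluct qr E Q vh Th \<xi> \<zeta> \<psi> \<theta> $ \<eta>\<bar>\<^sup>2)"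
proof -
  define v T G Z where "v = local_vel qr E Q \<xi> \<zeta> \<psi> \<theta>" and "T = local_traction qr E Q \<xi> \<zeta> \<psi> \<theta>"
    and "G = fluct qr E Q vh Th \<xi> \<zeta> \<psi> \<theta>" and "Z = impedance E \<xi> p"
  have p: "p \<in> ref_cube" "p $ \<xi> = \<zeta>"
    using face_pt_in_ref_cube[OF assms(1) _ idx] \<zeta> by (auto simp: p_def face_pt_def)
  have R: "rot E \<xi> \<zeta> p *v vel (face_val qr \<xi> \<zeta> Q \<psi> \<theta>) = v"
    "rot E \<xi> \<zeta> p *v face_traction qr E Q \<xi> \<zeta> \<psi> \<theta> = T"
    by (simp_all add: v_def T_def local_vel_def local_traction_def face_vel_def p_def)
  have VF: "face_val qr \<xi> \<zeta> (\<lambda>m. vel (Q m)) \<psi> \<theta> \<bullet> face_val qr \<xi> \<zeta> (\<lambda>m. vel (F_nodal qr E \<xi> Q m)) \<psi> \<theta>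
      = surf E \<xi> p * (v \<bullet> T)"
    using rot_inner[OF assms(2) p(1) \<zeta> p(2)] face_val_F_nodal[OF assms(1,2) \<zeta> idx, of \<xi> Q]
    by (simp flip: vel_face_val R add: p_def)
  \<comment> \<open>The pairing with the stress part of the penalty yields the interpolated stress
    applied to the normal, which is replaced by the traction here.\<close>
  have QF: "face_val qr \<xi> \<zeta> Q \<psi> \<theta> \<bullet> FLR qr E Q vh Th \<xi> \<zeta> \<psi> \<theta>
      = (\<Sum>\<eta>\<in>UNIV. v $ \<eta> * G $ \<eta> + s * T $ \<eta> * (G $ \<eta> / Z $ \<eta>))"
    using inner_FLR[OF \<zeta> meta_eq_to_obj_eq[OF p_def] refl G_def, of "face_val qr \<xi> \<zeta> Q \<psi> \<theta>"]
    unfolding R face_traction_eq_stress_normal[OF assms(1-3) \<zeta> idx, of \<xi>, folded p_def, symmetric]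
    by (simp add: s_def Z_def)
  have "s * (v $ \<eta> * T $ \<eta>) - (v $ \<eta> * G $ \<eta> + s * T $ \<eta> * (G $ \<eta> / Z $ \<eta>))
      = s * (Th \<xi> \<zeta> \<psi> \<theta> $ \<eta> * vh \<xi> \<zeta> \<psi> \<theta> $ \<eta>) - 1 / Z $ \<eta> * (G $ \<eta>)\<^sup>2" for \<eta>
  proof (cases "\<zeta> = 1")
    case True
    have "v $ \<eta> * T $ \<eta> - (v $ \<eta> * G $ \<eta> + T $ \<eta> * (G $ \<eta> / Z $ \<eta>))
        = Th \<xi> \<zeta> \<psi> \<theta> $ \<eta> * vh \<xi> \<zeta> \<psi> \<theta> $ \<eta> - 1 / Z $ \<eta> * (G $ \<eta>)\<^sup>2"
    proof (rule hat_identity_right)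
      show "Z $ \<eta> > 0" unfolding Z_def by (rule impedance_pos[OF assms(2) p(1)])
      show "Z $ \<eta> * vh \<xi> \<zeta> \<psi> \<theta> $ \<eta> - Th \<xi> \<zeta> \<psi> \<theta> $ \<eta> = 2 * ((Z $ \<eta> * v $ \<eta> - T $ \<eta>) / 2)"
        using assms(4) idx True by (simp add: hat_compatible_def char_p_def Z_def v_def T_def p_def)
      show "G $ \<eta> = Z $ \<eta> * (v $ \<eta> - vh \<xi> \<zeta> \<psi> \<theta> $ \<eta>) / 2 + (T $ \<eta> - Th \<xi> \<zeta> \<psi> \<theta> $ \<eta>) / 2"
        using True by (simp add: G_def fluct_def Let_def Z_def v_def T_def p_def)
    qed
    then show ?thesis using True by (simp add: s_def)
  next
    case False
    then have 0: "\<zeta> = 0" using \<zeta> by simp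
    have "- (v $ \<eta> * T $ \<eta>) - (v $ \<eta> * G $ \<eta> - T $ \<eta> * (G $ \<eta> / Z $ \<eta>))
        = - (Th \<xi> \<zeta> \<psi> \<theta> $ \<eta> * vh \<xi> \<zeta> \<psi> \<theta> $ \<eta>) - 1 / Z $ \<eta> * (G $ \<eta>)\<^sup>2"
    proof (rule hat_identity_left)
      show "Z $ \<eta> > 0" unfolding Z_def by (rule impedance_pos[OF assms(2) p(1)])
      show "Z $ \<eta> * vh \<xi> \<zeta> \<psi> \<theta> $ \<eta> + Th \<xi> \<zeta> \<psi> \<theta> $ \<eta> = 2 * ((Z $ \<eta> * v $ \<eta> + T $ \<eta>) / 2)"
        using assms(4) idx 0 by (simp add: hat_compatible_def char_q_def Z_def v_def T_def p_def)
      show "G $ \<eta> = Z $ \<eta> * (v $ \<eta> - vh \<xi> \<zeta> \<psi> \<theta> $ \<eta>) / 2 - (T $ \<eta> - Th \<xi> \<zeta> \<psi> \<theta> $ \<eta>) / 2"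
        using 0 by (simp add: G_def fluct_def Let_def Z_def v_def T_def p_def)
    qed
    then show ?thesis using 0 by (simp add: s_def)
  qed
  then have bal: "s * (v \<bullet> T) - (\<Sum>\<eta>\<in>UNIV. v $ \<eta> * G $ \<eta> + s * T $ \<eta> * (G $ \<eta> / Z $ \<eta>))
      = s * (\<Sum>\<eta>\<in>UNIV. Th \<xi> \<zeta> \<psi> \<theta> $ \<eta> * vh \<xi> \<zeta> \<psi> \<theta> $ \<eta>) - (\<Sum>\<eta>\<in>UNIV. 1 / Z $ \<eta> * (G $ \<eta>)\<^sup>2)"
    unfolding inner_vec_def sum_distrib_left sum_subtractf[symmetric] inner_real_def by simp
  have scale: "s * (c * x) - c * y = s * (c * z) - c * w" if "s * x - y = s * z - w" for c x y z w :: real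
    using arg_cong[OF that, of "\<lambda>r. c * r"] by (simp add: algebra_simps)
  show ?thesis
    unfolding inner_scaleR_right power2_abs Z_def[symmetric] G_def[symmetric] VF QF
    by (rule scale[OF bal])
qed

lemma element_energy_balance:
  assumes qr: "valid_quadrature qr" "exact_up_to qr (2 * qdeg qr - 1)" and E: "valid_element E"
    and "traction_compatible qr E Q" "hat_compatible qr E Q vh Th"
  shows "(\<Sum>m\<in>nodes qr. node_weight qr m * (Q m \<bullet> scheme_rhs qr E Q vh Th m))
       = (\<Sum>\<xi>\<in>UNIV. face_power qr E vh Th \<xi> 1 - face_power qr E vh Th \<xi> 0) + F_luc qr E Q vh Th"
proof -
  define V where "V = (\<lambda>m. vel (Q m))"
  define F where "F \<xi> m = vel (F_nodal qr E \<xi> Q m)" for \<xi> m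
  define g where "g \<xi> \<zeta> \<psi> \<theta> = surf E \<xi> (face_pt qr \<xi> \<zeta> \<psi> \<theta>) *\<^sub>R FLR qr E Q vh Th \<xi> \<zeta> \<psi> \<theta>" for \<xi> \<zeta> \<psi> \<theta>
  define diss where "diss \<xi> \<zeta> = face_sum qr (\<lambda>\<psi> \<theta>. surf E \<xi> (face_pt qr \<xi> \<zeta> \<psi> \<theta>) *
            (\<Sum>\<eta>\<in>UNIV. 1 / impedance E \<xi> (face_pt qr \<xi> \<zeta> \<psi> \<theta>) $ \<eta>
                         * \<bar>fluct qr E Q vh Th \<xi> \<zeta> \<psi> \<theta> $ \<eta>\<bar>\<^sup>2))" for \<xi> \<zeta>
  \<comment> \<open>For each direction the flux term and the non-conservative term form the pattern
    of the product rule, ready for summation by parts.\<close>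
  have "Q m \<bullet> scheme_rhs qr E Q vh Th m
      = (\<Sum>\<xi>\<in>UNIV. V m \<bullet> D_op qr \<xi> (F \<xi>) m + D_op qr \<xi> V m \<bullet> F \<xi> m
          - (Q m \<bullet> H_inv qr \<xi> (face_ext qr \<xi> 0 (g \<xi> 0)) m
             + Q m \<bullet> H_inv qr \<xi> (face_ext qr \<xi> 1 (g \<xi> 1)) m))" for m
    by (simp add: scheme_rhs_def num_Flux_def inner_add_right inner_diff_right inner_sum_right
          inner_D_op_F_nodal inner_flux_B vel_D_op sum.distrib sum_subtractf V_def F_def[abs_def] g_def[abs_def]
          H_inv_def scaleR_add_right inner_commute[of "vel (F_nodal _ _ _ _ _)"])
  then have "(\<Sum>m\<in>nodes qr. node_weight qr m * (Q m \<bullet> scheme_rhs qr E Q vh Th m))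
      = (\<Sum>m\<in>nodes qr. \<Sum>\<xi>\<in>UNIV. node_weight qr m * (V m \<bullet> D_op qr \<xi> (F \<xi>) m + D_op qr \<xi> V m \<bullet> F \<xi> m)
          - (node_weight qr m * (Q m \<bullet> H_inv qr \<xi> (face_ext qr \<xi> 0 (g \<xi> 0)) m)
             + node_weight qr m * (Q m \<bullet> H_inv qr \<xi> (face_ext qr \<xi> 1 (g \<xi> 1)) m)))"
    by (simp only: sum_distrib_left right_diff_distrib distrib_left)
  also have "\<dots> = (\<Sum>\<xi>\<in>UNIV.
        face_sum qr (\<lambda>\<psi> \<theta>. face_val qr \<xi> 1 V \<psi> \<theta> \<bullet> face_val qr \<xi> 1 (F \<xi>) \<psi> \<theta>)
      - face_sum qr (\<lambda>\<psi> \<theta>. face_val qr \<xi> 0 V \<psi> \<theta> \<bullet> face_val qr \<xi> 0 (F \<xi>) \<psi> \<theta>)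
      - (face_sum qr (\<lambda>\<psi> \<theta>. face_val qr \<xi> 0 Q \<psi> \<theta> \<bullet> g \<xi> 0 \<psi> \<theta>)
         + face_sum qr (\<lambda>\<psi> \<theta>. face_val qr \<xi> 1 Q \<psi> \<theta> \<bullet> g \<xi> 1 \<psi> \<theta>)))"
    by (subst sum.swap) (simp only: sum_subtractf sum.distrib nodal_summation_by_parts[OF qr] nodal_face_pairing[OF qr(1)])
  also have "\<dots> = (\<Sum>\<xi>\<in>UNIV. face_power qr E vh Th \<xi> 1 - face_power qr E vh Th \<xi> 0 - (diss \<xi> 0 + diss \<xi> 1))"
  proof (rule sum.cong[OF refl])
    fix \<xi> :: 3
    \<comment> \<open>At \<zeta> = 1 the boundary term from summation by parts enters with a plus
      sign, at \<zeta> = 0 with a minus sign; each is combined with the penalty on its own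
      face.\<close>
    have "face_sum qr (\<lambda>\<psi> \<theta>. face_val qr \<xi> 1 V \<psi> \<theta> \<bullet> face_val qr \<xi> 1 (F \<xi>) \<psi> \<theta>)
        - face_sum qr (\<lambda>\<psi> \<theta>. face_val qr \<xi> 1 Q \<psi> \<theta> \<bullet> g \<xi> 1 \<psi> \<theta>) = face_power qr E vh Th \<xi> 1 - diss \<xi> 1"
      unfolding diss_def face_power_def face_sum_diff[symmetric] V_def F_def[abs_def] g_def
      using face_balance[OF qr(1) E assms(4,5), of 1 _ _ \<xi>] by (intro face_sum_cong) simp
    moreover have "- face_sum qr (\<lambda>\<psi> \<theta>. face_val qr \<xi> 0 V \<psi> \<theta> \<bullet> face_val qr \<xi> 0 (F \<xi>) \<psi> \<theta>)
        - face_sum qr (\<lambda>\<psi> \<theta>. face_val qr \<xi> 0 Q \<psi> \<theta> \<bullet> g \<xi> 0 \<psi> \<theta>) = - face_power qr E vh Th \<xi> 0 - diss \<xi> 0"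
      unfolding diss_def face_power_def face_sum_uminus[symmetric] face_sum_diff[symmetric] V_def F_def[abs_def] g_def
      using face_balance[OF qr(1) E assms(4,5), of 0 _ _ \<xi>] by (intro face_sum_cong) simp
    ultimately show "face_sum qr (\<lambda>\<psi> \<theta>. face_val qr \<xi> 1 V \<psi> \<theta> \<bullet> face_val qr \<xi> 1 (F \<xi>) \<psi> \<theta>)
      - face_sum qr (\<lambda>\<psi> \<theta>. face_val qr \<xi> 0 V \<psi> \<theta> \<bullet> face_val qr \<xi> 0 (F \<xi>) \<psi> \<theta>)
      - (face_sum qr (\<lambda>\<psi> \<theta>. face_val qr \<xi> 0 Q \<psi> \<theta> \<bullet> g \<xi> 0 \<psi> \<theta>)
         + face_sum qr (\<lambda>\<psi> \<theta>. face_val qr \<xi> 1 Q \<psi> \<theta> \<bullet> g \<xi> 1 \<psi> \<theta>))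
      = face_power qr E vh Th \<xi> 1 - face_power qr E vh Th \<xi> 0 - (diss \<xi> 0 + diss \<xi> 1)"
      by linarith
  qed
  also have "\<dots> = (\<Sum>\<xi>\<in>UNIV. face_power qr E vh Th \<xi> 1 - face_power qr E vh Th \<xi> 0) + F_luc qr E Q vh Th"
    by (simp add: F_luc_def diss_def sum_subtractf)
  finally show ?thesis .
qed

section \<open>Time derivative of the energy\<close>

lemma energy_eq_sum_nodes:
  "energy qr E Q = 1/2 * (\<Sum>m\<in>nodes qr. node_weight qr m * (Q m \<bullet> (matrix_inv (P_tilde E (node_pt qr m)) *v Q m)))"
  \<comment> \<open>Direction 3 is chosen since there \<open>insert_dir\<close> yields
    \<open>vector [\<psi>, \<theta>, l]\<close>, the order of summation in the energy.\<close>
  by (simp add: energy_def Let_def sum_nodes[where \<xi> = 3] node_weight_insert_dir)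
     (simp add: insert_dir_def mult_ac)

lemma energy_has_derivative:
  assumes "valid_quadrature qr" "valid_element E" "semidiscrete_solution qr E I Q vh Th" "t \<in> I"
  shows "((\<lambda>\<tau>. energy qr E (Q \<tau>)) has_real_derivative
           (\<Sum>m\<in>nodes qr. node_weight qr m * (Q t m \<bullet> scheme_rhs qr E (Q t) (vh t) (Th t) m))) (at t within I)"
proof -
  define M where "M m = matrix_inv (P_tilde E (node_pt qr m))" for m
  obtain Q' where Q': "((\<lambda>\<tau>. Q \<tau> m) has_vector_derivative Q' m) (at t within I)"
      "M m *v Q' m = scheme_rhs qr E (Q t) (vh t) (Th t) m" if "m \<in> nodes qr" for m
    using assms(3,4) unfolding semidiscrete_solution_def M_def by metis
  have "((\<lambda>\<tau>. Q \<tau> m \<bullet> (M m *v Q \<tau> m)) has_real_derivative 2 * (Q t m \<bullet> scheme_rhs qr E (Q t) (vh t) (Th t) m))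
          (at t within I)" if m: "m \<in> nodes qr" for m
  proof -
    have "((\<lambda>\<tau>. Q \<tau> m \<bullet> (M m *v Q \<tau> m)) has_vector_derivative (Q t m \<bullet> (M m *v Q' m) + Q' m \<bullet> (M m *v Q t m)))
          (at t within I)"
      by (intro bounded_bilinear.has_vector_derivative[OF bounded_bilinear_inner] Q'(1)[OF m]
            bounded_linear.has_vector_derivative[OF matrix_vector_mul_bounded_linear])
    \<comment> \<open>Symmetry of the inverse of \<open>P_tilde\<close> merges the two product rule
      terms into twice one of them, which cancels the factor 1/2 of the energy.\<close>
    moreover have "Q' m \<bullet> (M m *v Q t m) = Q t m \<bullet> (M m *v Q' m)"
      using P_tilde_inv_symmetric[OF assms(2) node_pt_in_ref_cube[OF assms(1) m]]
      by (metis M_def dot_lmul_matrix inner_commute transpose_matrix_vector)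
    ultimately show ?thesis
      using Q'(2)[OF m] by (simp add: has_real_derivative_iff_has_vector_derivative)
  qed
  then have "((\<lambda>\<tau>. 1/2 * (\<Sum>m\<in>nodes qr. node_weight qr m * (Q \<tau> m \<bullet> (M m *v Q \<tau> m)))) has_real_derivative
      1/2 * (\<Sum>m\<in>nodes qr. node_weight qr m * (2 * (Q t m \<bullet> scheme_rhs qr E (Q t) (vh t) (Th t) m)))) (at t within I)"
    by (intro DERIV_cmult DERIV_sum)
  then show ?thesis
    by (simp add: energy_eq_sum_nodes M_def sum_distrib_left)
qed

section \<open>Boundary and interface data\<close>

text \<open>The factors \<open>1 + \<gamma>\<close> and \<open>1 - \<gamma>\<close> add up to 2, so
  the reflection coefficient drops out of the kept characteristic.\<close>

lemma hat_ext_compatible: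
  assumes "Z = impedance E \<xi> (face_pt qr \<xi> \<zeta> \<psi> \<theta>) $ \<eta>" "Z > 0"
  shows "\<zeta> = 0 \<Longrightarrow> Z * vhat_ext qr E Q \<xi> \<zeta> \<psi> \<theta> $ \<eta> + That_ext qr E Q \<xi> \<zeta> \<psi> \<theta> $ \<eta> = 2 * char_q qr E Q \<xi> \<zeta> \<psi> \<theta> $ \<eta>"
    and "\<zeta> = 1 \<Longrightarrow> Z * vhat_ext qr E Q \<xi> \<zeta> \<psi> \<theta> $ \<eta> - That_ext qr E Q \<xi> \<zeta> \<psi> \<theta> $ \<eta> = 2 * char_p qr E Q \<xi> \<zeta> \<psi> \<theta> $ \<eta>"
  using assms(2) unfolding vhat_ext_def That_ext_def Let_def vec_lambda_beta assms(1)[symmetric]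
  by (simp_all add: field_simps)

text \<open>The hat-variables solve the interface Riemann problem: a common traction and velocity
  preserving \<open>p\<close> of the minus side and \<open>q\<close> of the plus side. Each hat
  velocity is defined from the data of the opposite side, so equality of the two is proved first and
  then gives each side its own characteristic.\<close>

lemma hat_int_identities:
  fixes Zm Zp p q :: real
  assumes "Zm > 0" "Zp > 0"
  defines "T \<equiv> Zp * Zm / (Zp + Zm) * (2 / Zp * q - 2 / Zm * p)"
  shows "Zm * ((2 * q - T) / Zp) - T = 2 * p" "Zp * ((2 * p + T) / Zm) + T = 2 * q"
    "(2 * p + T) / Zm = (2 * q - T) / Zp"
proof -
  have nz: "Zp + Zm \<noteq> 0" "Zp \<noteq> 0" "Zm \<noteq> 0" using assms by auto
  then have "T * (Zp + Zm) = Zp * Zm * (2 / Zp * q - 2 / Zm * p)"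
    by (simp add: T_def)
  also have "\<dots> = 2 * Zm * q - 2 * Zp * p"
    using nz by (simp add: right_diff_distrib)
  finally have T: "T * (Zp + Zm) = 2 * Zm * q - 2 * Zp * p" .
  show c: "(2 * p + T) / Zm = (2 * q - T) / Zp"
    using T nz by (simp add: frac_eq_eq algebra_simps)
  have *: "2 * q - T = Zp * ((2 * p + T) / Zm)" unfolding c using nz by simp
  have **: "2 * p + T = Zm * ((2 * q - T) / Zp)" unfolding c[symmetric] using nz by simp
  show "Zm * ((2 * q - T) / Zp) - T = 2 * p" using ** by linarith
  show "Zp * ((2 * p + T) / Zm) + T = 2 * q" using * by linarith
qed

lemma interface_impedance_pos:
  assumes "valid_quadrature qr" "valid_element Em" "valid_element Ep" "\<psi> \<in> idx qr" "\<theta> \<in> idx qr"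
  shows "Z_minus qr Em \<psi> \<theta> $ \<eta> > 0" "Z_plus qr Ep \<psi> \<theta> $ \<eta> > 0"
  using assms by (auto simp: Z_minus_def Z_plus_def intro!: impedance_pos face_pt_in_ref_cube)

lemma hat_minus_compatible:
  assumes "valid_quadrature qr" "valid_element Em" "valid_element Ep"
  shows "hat_compatible qr Em Qm (vhat_minus qr Em Ep Qm Qp) (That_minus qr Em Ep Qm Qp)"
  unfolding hat_compatible_def
proof (intro allI ballI conjI)
  fix \<xi> \<eta> :: 3 and \<psi> \<theta> assume i: "\<psi> \<in> idx qr" "\<theta> \<in> idx qr"
  have Z: "impedance Em \<xi> (face_pt qr \<xi> \<zeta> \<psi> \<theta>) $ \<eta> > 0" if "\<zeta> \<in> {0, 1}" for \<zeta>
    using that by (intro impedance_pos[OF assms(2)] face_pt_in_ref_cube[OF assms(1) _ i]) auto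
  show "impedance Em \<xi> (face_pt qr \<xi> 0 \<psi> \<theta>) $ \<eta> * vhat_minus qr Em Ep Qm Qp \<xi> 0 \<psi> \<theta> $ \<eta>
          + That_minus qr Em Ep Qm Qp \<xi> 0 \<psi> \<theta> $ \<eta> = 2 * char_q qr Em Qm \<xi> 0 \<psi> \<theta> $ \<eta>"
    using hat_ext_compatible(1)[OF refl Z] by (simp add: vhat_minus_def That_minus_def)
  show "impedance Em \<xi> (face_pt qr \<xi> 1 \<psi> \<theta>) $ \<eta> * vhat_minus qr Em Ep Qm Qp \<xi> 1 \<psi> \<theta> $ \<eta>
          - That_minus qr Em Ep Qm Qp \<xi> 1 \<psi> \<theta> $ \<eta> = 2 * char_p qr Em Qm \<xi> 1 \<psi> \<theta> $ \<eta>"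
  \<comment> \<open>For the first element interface data occur on the face \<open>q = 1\<close>
    only.\<close>
  proof (cases "\<xi> = 1")
    case True
    then show ?thesis
      using hat_int_identities(1)[OF interface_impedance_pos[OF assms i]]
      by (simp add: vhat_minus_def That_minus_def vhat_int_minus_def That_int_def Let_def flip: Z_minus_def)
  next
    case False
    then show ?thesis
      using hat_ext_compatible(2)[OF refl Z] by (simp add: vhat_minus_def That_minus_def)
  qed
qed

lemma hat_plus_compatible:
  assumes "valid_quadrature qr" "valid_element Em" "valid_element Ep"
  shows "hat_compatible qr Ep Qp (vhat_plus qr Em Ep Qm Qp) (That_plus qr Em Ep Qm Qp)"
  unfolding hat_compatible_def
proof (intro allI ballI conjI)
  fix \<xi> \<eta> :: 3 and \<psi> \<theta> assume i: "\<psi> \<in> idx qr" "\<theta> \<in> idx qr"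
  have Z: "impedance Ep \<xi> (face_pt qr \<xi> \<zeta> \<psi> \<theta>) $ \<eta> > 0" if "\<zeta> \<in> {0, 1}" for \<zeta>
    using that by (intro impedance_pos[OF assms(3)] face_pt_in_ref_cube[OF assms(1) _ i]) auto
  show "impedance Ep \<xi> (face_pt qr \<xi> 1 \<psi> \<theta>) $ \<eta> * vhat_plus qr Em Ep Qm Qp \<xi> 1 \<psi> \<theta> $ \<eta>
          - That_plus qr Em Ep Qm Qp \<xi> 1 \<psi> \<theta> $ \<eta> = 2 * char_p qr Ep Qp \<xi> 1 \<psi> \<theta> $ \<eta>"
    using hat_ext_compatible(2)[OF refl Z] by (simp add: vhat_plus_def That_plus_def)
  show "impedance Ep \<xi> (face_pt qr \<xi> 0 \<psi> \<theta>) $ \<eta> * vhat_plus qr Em Ep Qm Qp \<xi> 0 \<psi> \<theta> $ \<eta>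
          + That_plus qr Em Ep Qm Qp \<xi> 0 \<psi> \<theta> $ \<eta> = 2 * char_q qr Ep Qp \<xi> 0 \<psi> \<theta> $ \<eta>"
  proof (cases "\<xi> = 1")
    case True
    then show ?thesis
      using hat_int_identities(2)[OF interface_impedance_pos[OF assms i]]
      by (simp add: vhat_plus_def That_plus_def vhat_int_plus_def That_int_def Let_def flip: Z_plus_def)
  next
    case False
    then show ?thesis
      using hat_ext_compatible(1)[OF refl Z] by (simp add: vhat_plus_def That_plus_def)
  qed
qed

lemma vhat_int_continuous:
  assumes "valid_quadrature qr" "valid_element Em" "valid_element Ep" "\<psi> \<in> idx qr" "\<theta> \<in> idx qr"
  shows "vhat_int_plus qr Em Ep Qm Qp \<psi> \<theta> $ \<eta> = vhat_int_minus qr Em Ep Qm Qp \<psi> \<theta> $ \<eta>"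
  using hat_int_identities(3)[OF interface_impedance_pos[OF assms]]
  by (simp add: vhat_int_plus_def vhat_int_minus_def That_int_def Let_def)

lemma IT_s_eq_0:
  assumes "valid_quadrature qr" "valid_element Em" "valid_element Ep"
  shows "IT_s qr Em Ep Qm Qp = 0"
  using vhat_int_continuous[OF assms] by (simp add: IT_s_def face_sum_def)

text \<open>The traction is shared by definition, the velocity by the Riemann solution and the
  surface factor by the geometry. The two powers enter the total rate with opposite signs and
  cancel.\<close>

lemma interface_power:
  assumes "valid_quadrature qr" "valid_element Em" "valid_element Ep" "common_interface Em Ep"
  shows "face_power qr Em (vhat_minus qr Em Ep Qm Qp) (That_minus qr Em Ep Qm Qp) 1 1
       = face_power qr Ep (vhat_plus qr Em Ep Qm Qp) (That_plus qr Em Ep Qm Qp) 1 0"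
proof -
  have "surf Em 1 (face_pt qr 1 1 \<psi> \<theta>) = surf Ep 1 (face_pt qr 1 0 \<psi> \<theta>)"
    if "\<psi> \<in> idx qr" "\<theta> \<in> idx qr" for \<psi> \<theta>
    using that assms(1) unfolding face_pt_def valid_quadrature_def
    by (intro surf_interface[OF assms(2-4)]) auto
  then show ?thesis
    unfolding face_power_def
    by (intro face_sum_cong)
       (simp add: vhat_minus_def vhat_plus_def That_minus_def That_plus_def vhat_int_continuous[OF assms(1-3)])
qed

section \<open>Signs of the boundary power and of the dissipation\<close>

lemma face_power_ext_sign:
  assumes "valid_quadrature qr" "valid_element E"
    and vh: "vh \<xi> \<zeta> = vhat_ext qr E Q \<xi> \<zeta>" "Th \<xi> \<zeta> = That_ext qr E Q \<xi> \<zeta>"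
  shows "\<zeta> = 0 \<Longrightarrow> face_power qr E vh Th \<xi> \<zeta> \<ge> 0" and "\<zeta> = 1 \<Longrightarrow> face_power qr E vh Th \<xi> \<zeta> \<le> 0"
proof -
  have *: "(if \<zeta> = 0 then 1 else -1) * (Th \<xi> \<zeta> \<psi> \<theta> $ \<eta> * vh \<xi> \<zeta> \<psi> \<theta> $ \<eta>) \<ge> 0"
    and surf: "surf E \<xi> (face_pt qr \<xi> \<zeta> \<psi> \<theta>) > 0"
    if \<zeta>: "\<zeta> \<in> {0, 1}" and i: "\<psi> \<in> idx qr" "\<theta> \<in> idx qr" for \<psi> \<theta> \<eta>
  proof -
    let ?p = "face_pt qr \<xi> \<zeta> \<psi> \<theta>"
    have p: "?p \<in> ref_cube" "?p $ \<xi> = \<zeta>"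
      using \<zeta> face_pt_in_ref_cube[OF assms(1) _ i] by (auto simp: face_pt_def)
    show "surf E \<xi> ?p > 0" by (rule surf_pos[OF assms(2) p(1)])
    have "\<bar>refl E \<xi> \<zeta> ?p \<eta>\<bar> \<le> 1"
      using assms(2) p \<zeta> unfolding valid_element_def by blast
    then have *: "(1 - refl E \<xi> \<zeta> ?p \<eta>) * (1 + refl E \<xi> \<zeta> ?p \<eta>) \<ge> 0" by (intro mult_nonneg_nonneg) auto
    \<comment> \<open>With \<open>c\<close> the kept characteristic, this quotient is the product of
      the two hat-variables, up to the sign that belongs to the face.\<close>
    have "(1 - refl E \<xi> \<zeta> ?p \<eta>) * (1 + refl E \<xi> \<zeta> ?p \<eta>) * c\<^sup>2 / impedance E \<xi> ?p $ \<eta> \<ge> 0" for c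
      by (intro divide_nonneg_pos mult_nonneg_nonneg[OF *] zero_le_power2 impedance_pos[OF assms(2) p(1)])
    then show "(if \<zeta> = 0 then 1 else -1) * (Th \<xi> \<zeta> \<psi> \<theta> $ \<eta> * vh \<xi> \<zeta> \<psi> \<theta> $ \<eta>) \<ge> 0"
      using \<zeta> by (auto simp: vh vhat_ext_def That_ext_def Let_def power2_eq_square mult_ac)
  qed
  show "face_power qr E vh Th \<xi> \<zeta> \<ge> 0" if "\<zeta> = 0"
    unfolding face_power_def using that *
    by (intro face_sum_nonneg[OF assms(1)] mult_nonneg_nonneg[OF less_imp_le[OF surf] sum_nonneg]) auto
  have "0 \<le> face_sum qr (\<lambda>\<psi> \<theta>. - (surf E \<xi> (face_pt qr \<xi> \<zeta> \<psi> \<theta>) *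
       (\<Sum>\<eta>\<in>UNIV. Th \<xi> \<zeta> \<psi> \<theta> $ \<eta> * vh \<xi> \<zeta> \<psi> \<theta> $ \<eta>)))" if "\<zeta> = 1"
    unfolding mult_minus_right[symmetric] sum_negf[symmetric] using that *
    by (intro face_sum_nonneg[OF assms(1)] mult_nonneg_nonneg[OF less_imp_le[OF surf] sum_nonneg]) auto
  then show "face_power qr E vh Th \<xi> \<zeta> \<le> 0" if "\<zeta> = 1"
    using that unfolding face_sum_uminus by (simp add: face_power_def)
qed

lemma F_luc_nonpos:
  assumes "valid_quadrature qr" "valid_element E"
  shows "F_luc qr E Q vh Th \<le> 0"
proof -
  have "0 \<le> surf E \<xi> (face_pt qr \<xi> \<zeta> \<psi> \<theta>) *
            (\<Sum>\<eta>\<in>UNIV. 1 / impedance E \<xi> (face_pt qr \<xi> \<zeta> \<psi> \<theta>) $ \<eta>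
                         * \<bar>fluct qr E Q vh Th \<xi> \<zeta> \<psi> \<theta> $ \<eta>\<bar>\<^sup>2)"
    if "\<zeta> \<in> {0, 1}" "\<psi> \<in> idx qr" "\<theta> \<in> idx qr" for \<xi> \<zeta> \<psi> \<theta>
  proof -
    have "face_pt qr \<xi> \<zeta> \<psi> \<theta> \<in> ref_cube"
      using face_pt_in_ref_cube[OF assms(1) _ that(2,3)] that(1) by auto
    then show ?thesis
      using surf_pos[OF assms(2)] impedance_pos[OF assms(2)]
      by (intro mult_nonneg_nonneg sum_nonneg) (auto intro: less_imp_le)
  qed
  then show ?thesis
    unfolding F_luc_def neg_le_0_iff_le by (intro sum_nonneg face_sum_nonneg[OF assms(1)])
qed

theorem theorem8:
  fixes qr :: quadrature and Em Ep :: element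
    and Qm Qp :: "real \<Rightarrow> state nodal" and I :: "real set"
  assumes "valid_quadrature qr"
    and "valid_element Em" and "valid_element Ep" and "common_interface Em Ep"
    and "exact_up_to qr (2 * qdeg qr - 1)"
    and "semidiscrete_solution qr Em I Qm
           (\<lambda>t. vhat_minus qr Em Ep (Qm t) (Qp t)) (\<lambda>t. That_minus qr Em Ep (Qm t) (Qp t))"
    and "semidiscrete_solution qr Ep I Qp
           (\<lambda>t. vhat_plus qr Em Ep (Qm t) (Qp t)) (\<lambda>t. That_plus qr Em Ep (Qm t) (Qp t))"
    and "t \<in> I"
    and "traction_compatible qr Em (Qm t)" and "traction_compatible qr Ep (Qp t)"
  shows "let vm = vhat_minus qr Em Ep (Qm t) (Qp t); Tm = That_minus qr Em Ep (Qm t) (Qp t);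
             vp = vhat_plus qr Em Ep (Qm t) (Qp t); Tp = That_plus qr Em Ep (Qm t) (Qp t);
             rate = IT_s qr Em Ep (Qm t) (Qp t)
                    + BT_minus qr Em vm Tm + BT_plus qr Ep vp Tp
                    + F_luc qr Em (Qm t) vm Tm + F_luc qr Ep (Qp t) vp Tp
         in ((\<lambda>\<tau>. energy qr Em (Qm \<tau>) + energy qr Ep (Qp \<tau>)) has_real_derivative rate) (at t within I)
            \<and> rate \<le> 0"
proof -
  define vm Tm vp Tp where "vm = vhat_minus qr Em Ep (Qm t) (Qp t)" and "Tm = That_minus qr Em Ep (Qm t) (Qp t)"
    and "vp = vhat_plus qr Em Ep (Qm t) (Qp t)" and "Tp = That_plus qr Em Ep (Qm t) (Qp t)"
  define rate where "rate = IT_s qr Em Ep (Qm t) (Qp t) + BT_minus qr Em vm Tm + BT_plus qr Ep vp Tp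
                    + F_luc qr Em (Qm t) vm Tm + F_luc qr Ep (Qp t) vp Tp"
  have hm: "hat_compatible qr Em (Qm t) vm Tm" and hp: "hat_compatible qr Ep (Qp t) vp Tp"
    unfolding vm_def Tm_def vp_def Tp_def
    using hat_minus_compatible hat_plus_compatible assms(1-3) by blast+
  have int: "face_power qr Em vm Tm 1 1 = face_power qr Ep vp Tp 1 0"
    unfolding vm_def Tm_def vp_def Tp_def by (rule interface_power[OF assms(1-4)])
  have IT: "IT_s qr Em Ep (Qm t) (Qp t) = 0"
    by (rule IT_s_eq_0[OF assms(1-3)])
  have "((\<lambda>\<tau>. energy qr Em (Qm \<tau>) + energy qr Ep (Qp \<tau>)) has_real_derivative
      ((\<Sum>\<xi>\<in>UNIV. face_power qr Em vm Tm \<xi> 1 - face_power qr Em vm Tm \<xi> 0) + F_luc qr Em (Qm t) vm Tm)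
      + ((\<Sum>\<xi>\<in>UNIV. face_power qr Ep vp Tp \<xi> 1 - face_power qr Ep vp Tp \<xi> 0) + F_luc qr Ep (Qp t) vp Tp))
      (at t within I)"
    using energy_has_derivative[OF assms(1,2,6,8)] energy_has_derivative[OF assms(1,3,7,8)]
    unfolding vm_def[symmetric] Tm_def[symmetric] vp_def[symmetric] Tp_def[symmetric]
      element_energy_balance[OF assms(1,5,2,9) hm] element_energy_balance[OF assms(1,5,3,10) hp]
    by (rule DERIV_add)
  \<comment> \<open>The interface powers cancel, the remaining face powers are exactly the two
    boundary terms, and \<open>IT_s\<close> contributes zero.\<close>
  moreover have "(\<Sum>\<xi>\<in>UNIV. face_power qr Em vm Tm \<xi> 1 - face_power qr Em vm Tm \<xi> 0) + F_luc qr Em (Qm t) vm Tm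
      + ((\<Sum>\<xi>\<in>UNIV. face_power qr Ep vp Tp \<xi> 1 - face_power qr Ep vp Tp \<xi> 0) + F_luc qr Ep (Qp t) vp Tp) = rate"
    by (simp add: rate_def IT int BT_minus_def BT_plus_def sum_3)
  ultimately have "((\<lambda>\<tau>. energy qr Em (Qm \<tau>) + energy qr Ep (Qp \<tau>)) has_real_derivative rate) (at t within I)"
    by simp
  moreover have "BT_minus qr Em vm Tm \<le> 0"
  proof -
    \<comment> \<open>Excluding \<xi> = 1 at \<zeta> = 1 removes the interface; on the other faces
      the hat-variables are the external ones.\<close>
    have "face_power qr Em vm Tm \<xi> 0 \<ge> 0" and "\<xi> \<noteq> 1 \<Longrightarrow> face_power qr Em vm Tm \<xi> 1 \<le> 0" for \<xi>
      using face_power_ext_sign[OF assms(1,2), of vm \<xi> _ "Qm t" Tm]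
      by (simp_all add: vm_def Tm_def vhat_minus_def That_minus_def)
    from this(1)[of 1] this(1)[of 2] this(1)[of 3] this(2)[of 2] this(2)[of 3] show ?thesis
      by (simp add: BT_minus_def)
  qed
  moreover have "BT_plus qr Ep vp Tp \<le> 0"
  proof -
    have "face_power qr Ep vp Tp \<xi> 1 \<le> 0" and "\<xi> \<noteq> 1 \<Longrightarrow> face_power qr Ep vp Tp \<xi> 0 \<ge> 0" for \<xi>
      using face_power_ext_sign[OF assms(1,3), of vp \<xi> _ "Qp t" Tp]
      by (simp_all add: vp_def Tp_def vhat_plus_def That_plus_def)
    from this(1)[of 1] this(1)[of 2] this(1)[of 3] this(2)[of 2] this(2)[of 3] show ?thesis
      by (simp add: BT_plus_def)
  qed
  moreover have "F_luc qr Em (Qm t) vm Tm \<le> 0" "F_luc qr Ep (Qp t) vp Tp \<le> 0"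
    using F_luc_nonpos assms(1-3) by blast+
  ultimately show ?thesis
    unfolding Let_def vm_def[symmetric] Tm_def[symmetric] vp_def[symmetric] Tp_def[symmetric] rate_def[symmetric]
    by (simp add: rate_def IT)
qed

end
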